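(* Let $G=(V,E)$ be an amply regular graph with parameters $(n,d,\alpha,\beta)$ such that $n<3d-2\alpha$. Suppose that one of the following conditions holds: (1) $\beta=\alpha+1$ and $d> \alpha+\sqrt{6\alpha+\frac{1}{4}}+\frac{3}{2}$; (2) $\beta\ge\alpha+2$ and $d \ge \frac{3}{2}\beta + \frac{1}{2}\sqrt{4\alpha^2-3\beta^2+28\beta}$; (3) $\beta \geq \frac{2\sqrt{3}}{3}\alpha + 7$. Then the Lin--Lu--Yau curvature satisfies $\kappa(x,y)=\frac{2+\alpha}{d}$ for all $xy\in E$.
   Context: Graphs are simple and undirected. A $d$-regular graph $G$ with $n$ vertices which is neither complete nor empty (i.e. has at least one edge) is called amply regular with parameters $(n,d,\alpha,\beta)$ if any two adjacent vertices have exactly $\alpha$ common neighbors and any two vertices at distance $2$ have exactly $\beta$ common neighbors. Let $d(x,y)$ denote the combinatorial (shortest-path) distance in $G$. For two probability measures $\mu_1,\mu_2$ on $V$, the Wasserstein distance is $W_1(\mu_1,\mu_2)=\inf_{\pi}\sum_{y\in V}\sum_{x\in V}d(x,y)\pi(x,y)$, where the infimum is over all maps $\pi:V\times V\to[0,1]$ with $\mu_1(x)=\sum_{y\in V}\pi(x,y)$ for all $x\in V$ and $\mu_2(y)=\sum_{x\in V}\pi(x,y)$ for all $y\in V$. For $x\in V$ and $p\in[0,1]$, let $\mu_x^p$ be the probability measure with $\mu_x^p(x)=p$, $\mu_x^p(y)=\frac{1-p}{\deg(x)}$ if $xy\in E$, and $\mu_x^p(y)=0$ otherwise. The $p$-Ollivier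 curvature is $\kappa_p(x,y)=1-\frac{W_1(\mu_x^p,\mu_y^p)}{d(x,y)}$, and the Lin--Lu--Yau curvature is $\kappa(x,y)=\lim_{p\to1}\frac{\kappa_p(x,y)}{1-p}$ (limit over $p<1$). *)

theory Defs
  imports "HOL-Analysis.Analysis" "Graph_Theory.Graph_Theory"
begin

(* A finite simple undirected graph is a pair_graph of Graph_Theory: an edge xy is represented
   by the two arcs (x,y) and (y,x), so out_degree is the usual degree. *)

definition common_neighbors :: "'a pair_pre_digraph \<Rightarrow> 'a \<Rightarrow> 'a \<Rightarrow> 'a set" where
  "common_neighbors G x y = {z. (x, z) \<in> parcs G \<and> (y, z) \<in> parcs G}"

(* Shortest-path distance with unit arc weights; it is infinite between different components. *)
definition graph_dist :: "'a pair_pre_digraph \<Rightarrow> 'a \<Rightarrow> 'a \<Rightarrow> ereal" where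
  "graph_dist G x y = wf_digraph.\<mu> (with_proj G) (\<lambda>_. 1) x y"

definition amply_regular ::
  "'a pair_pre_digraph \<Rightarrow> nat \<Rightarrow> nat \<Rightarrow> nat \<Rightarrow> nat \<Rightarrow> bool" where
  "amply_regular G n d \<alpha> \<beta> \<longleftrightarrow>
     pair_graph G \<and>
     card (pverts G) = n \<and>
     (\<forall>x\<in>pverts G. out_degree (with_proj G) x = d) \<and>
     \<not> complete_digraph n (with_proj G) \<and>
     parcs G \<noteq> {} \<and>
     (\<forall>x\<in>pverts G. \<forall>y\<in>pverts G. (x, y) \<in> parcs G \<longrightarrow> card (common_neighbors G x y) = \<alpha>) \<and>
     (\<forall>x\<in>pverts G. \<forall>y\<in>pverts G. graph_dist G x y = 2 \<longrightarrow> card (common_neighbors G x y) = \<beta>)"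

(* Measures on the finite set of vertices are given by their point masses. *)

definition transport_plans ::
  "'a pair_pre_digraph \<Rightarrow> ('a \<Rightarrow> real) \<Rightarrow> ('a \<Rightarrow> real) \<Rightarrow> ('a \<Rightarrow> 'a \<Rightarrow> real) set" where
  "transport_plans G \<mu>1 \<mu>2 =
     {\<pi>. (\<forall>x\<in>pverts G. \<forall>y\<in>pverts G. \<pi> x y \<in> {0..1}) \<and>
          (\<forall>x\<in>pverts G. \<mu>1 x = (\<Sum>y\<in>pverts G. \<pi> x y)) \<and>
          (\<forall>y\<in>pverts G. \<mu>2 y = (\<Sum>x\<in>pverts G. \<pi> x y))}"

(* In ereal, \<infinity> * 0 = 0: pairs at infinite distance cost nothing unless mass is moved between them. *)
definition wasserstein ::
  "'a pair_pre_digraph \<Rightarrow> ('a \<Rightarrow> real) \<Rightarrow> ('a \<Rightarrow> real) \<Rightarrow> ereal" where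
  "wasserstein G \<mu>1 \<mu>2 =
     (INF \<pi>\<in>transport_plans G \<mu>1 \<mu>2.
        \<Sum>y\<in>pverts G. \<Sum>x\<in>pverts G. graph_dist G x y * ereal (\<pi> x y))"

definition lazy_walk :: "'a pair_pre_digraph \<Rightarrow> real \<Rightarrow> 'a \<Rightarrow> 'a \<Rightarrow> real" where
  "lazy_walk G p x y =
     (if y = x then p
      else if (x, y) \<in> parcs G then (1 - p) / real (out_degree (with_proj G) x)
      else 0)"

(* Intended for distinct x, y in the same component, where both extended reals are finite. *)
definition ollivier_curvature :: "'a pair_pre_digraph \<Rightarrow> real \<Rightarrow> 'a \<Rightarrow> 'a \<Rightarrow> real" where
  "ollivier_curvature G p x y =
     1 - real_of_ereal (wasserstein G (lazy_walk G p x) (lazy_walk G p y)) /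
         real_of_ereal (graph_dist G x y)"

(* Lim is unspecified when there is no limit, so existence has to be asserted separately. *)
definition lly_curvature :: "'a pair_pre_digraph \<Rightarrow> 'a \<Rightarrow> 'a \<Rightarrow> real" where
  "lly_curvature G x y = Lim (at_left 1) (\<lambda>p. ollivier_curvature G p x y / (1 - p))"

end

theory Submission
  imports Defs
begin

text \<open>
Let \<open>xy\<close> be an edge. Write \<open>\<Delta>\<close> for the \<open>\<alpha>\<close> common neighbours of \<open>x\<close> and \<open>y\<close>, \<open>A\<close> for the neighbours of \<open>x\<close>
outside \<open>\<Delta> \<union> {y}\<close>, \<open>B\<close> for the neighbours of \<open>y\<close> outside \<open>\<Delta> \<union> {x}\<close>, and \<open>m = d - 1 - \<alpha>\<close> for the
common size of \<open>A\<close> and \<open>B\<close>.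

Curvature and matchings. For \<open>p \<ge> 1 / 2\<close> the two lazy walks share exactly the mass \<open>(1 - p) / d\<close> at each of
the \<open>2 + \<alpha>\<close> points of \<open>{x, y} \<union> \<Delta>\<close>. All the remaining mass has to move by distance at least \<open>1\<close>, which
bounds the curvature by \<open>(2 + \<alpha>) / d\<close>. If the edges between \<open>A\<close> and \<open>B\<close> contain a perfect matching,
then distance \<open>1\<close> suffices and the bound is attained (\<open>wasserstein_lazy_walk_matching\<close>). The theorem
is therefore a statement about perfect matchings.

Hall's condition. If there is no perfect matching, then some nonempty \<open>S \<subseteq> A\<close> has fewer than \<open>|S|\<close>
neighbours in \<open>B\<close>; after shrinking \<open>S\<close>, or exchanging the roles of \<open>x\<close> and \<open>y\<close> and passing to the
vertices of \<open>B\<close> that \<open>S\<close> does not see, one may take \<open>2 |S| \<le> m + 1\<close>. For a vertex \<open>w\<close> let \<open>e(w)\<close> be the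
number of its neighbours in \<open>S\<close>. The sum of \<open>e(w)\<^sup>2\<close> counts common neighbours of pairs in \<open>S\<close>, hence is
at most \<open>|S| (d + (|S| - 1) \<beta>)\<close> (\<open>second_moment_le\<close>). On the other hand the parameters of the graph
determine the sum of \<open>e\<close> over \<open>\<Delta>\<close>, over \<open>A\<close>, over \<open>B\<close> and over the rest of the second sphere of \<open>x\<close> in
terms of a single unknown, the mean number \<open>b\<close> of neighbours that a vertex of \<open>S\<close> has in \<open>B\<close>. All the
edges from \<open>S\<close> into \<open>B\<close> end in fewer than \<open>|S|\<close> vertices, about half of \<open>B\<close> at most, and this concentration
makes the Cauchy-Schwarz lower bound for the sum of \<open>e(w)\<^sup>2\<close> exceed the upper bound, whatever the
value of \<open>b\<close> (\<open>density_inequality\<close>, \<open>no_deficient_set\<close>).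

The hypotheses. Counting the vertices at distance \<open>2\<close> from \<open>x\<close> turns \<open>n < 3 d - 2 \<alpha>\<close> into \<open>d \<le> 2 \<beta>\<close>. The
numerical conditions give \<open>\<beta> \<ge> \<alpha> + 2\<close>, or \<open>\<beta> = \<alpha> + 1\<close> together with \<open>m \<ge> 7\<close>. When \<open>\<beta> = \<alpha> + 1\<close> the
second moment does not exclude a set \<open>S\<close> consisting of one vertex without neighbours in \<open>B\<close>; this
case falls to a parity argument (\<open>no_isolated_exclusive_neighbour\<close>).
\<close>

section \<open>The extremal inequality\<close>

lemma square_div_ge_tangent:
  fixes z c l :: real
  assumes "0 \<le> c" and "c = 0 \<Longrightarrow> z = 0"
  shows "2 * l * z - l\<^sup>2 * c \<le> z\<^sup>2 / c"
proof (cases "c = 0")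
  case False
  with assms have "c > 0" by simp
  have "0 \<le> (z - l * c)\<^sup>2" by simp
  then have "(2 * l * z - l\<^sup>2 * c) * c \<le> z\<^sup>2"
    by (simp add: power2_eq_square algebra_simps)
  with \<open>c > 0\<close> show ?thesis by (simp add: pos_le_divide_eq)
qed (use assms in simp)

text \<open>
What remains of \<open>density_inequality\<close> once the unknown \<open>b\<close> has been eliminated and denominators have
been cleared. The expression is affine in \<open>\<epsilon>\<close>, so for \<open>\<epsilon> \<ge> 1\<close> it suffices to look at \<open>\<epsilon> = 1\<close> and
\<open>\<epsilon> = \<sigma>\<close>. There the substitution \<open>\<sigma> = s + 1\<close>, \<open>m = 2 \<sigma> + 1 + k\<close> makes positivity visible.
\<close>
lemma residual_polynomial_pos:
  fixes m \<epsilon> \<sigma> :: real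
  assumes "1 \<le> \<sigma>" and "2 * \<sigma> + 1 \<le> m" and "\<epsilon> \<le> \<sigma>"
    and "1 \<le> \<epsilon> \<or> \<epsilon> = 0 \<and> 7 \<le> m"
  shows "0 < m * \<sigma> * (3 * \<sigma> + m) * (m - \<sigma> - 4) + 4 * \<sigma>\<^sup>2 * (\<sigma> + 1)
           + \<epsilon> * ((m\<^sup>2 - 2 * \<sigma> * m - 7 * \<sigma>\<^sup>2) * (\<sigma> + 1) + (3 * \<sigma> + m)\<^sup>2 + 6 * \<sigma> * (\<sigma> + 1))"
    (is "0 < ?c + \<epsilon> * ?k")
proof (cases "\<epsilon> = 0")
  case True
  with assms have "0 \<le> m - \<sigma> - 4" by simp
  with assms have "0 \<le> m * \<sigma> * (3 * \<sigma> + m) * (m - \<sigma> - 4)"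
    by (intro mult_nonneg_nonneg) auto
  moreover have "0 < 4 * \<sigma>\<^sup>2 * (\<sigma> + 1)" using assms by simp
  ultimately have "0 < m * \<sigma> * (3 * \<sigma> + m) * (m - \<sigma> - 4) + 4 * \<sigma>\<^sup>2 * (\<sigma> + 1)"
    by (rule add_nonneg_pos)
  then show ?thesis using True by simp
next
  case False
  with assms have \<epsilon>: "1 \<le> \<epsilon>" by blast
  define s k where "s = \<sigma> - 1" and "k = m - 2 * \<sigma> - 1"
  have sk: "0 \<le> s" "0 \<le> k" using assms by (auto simp: s_def k_def)
  have \<sigma>: "\<sigma> = s + 1" and m: "m = 2 * s + 3 + k" by (auto simp: s_def k_def)
  have one: "0 < ?c + 1 * ?k"
  proof -
    have "?c + 1 * ?k = 10 * (s\<^sup>2 - 1 / 2)\<^sup>2 + 14 * s ^ 3 + 2 * (s - 1 / 2)\<^sup>2 + 9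
        + k * (17 * s ^ 3 + 41 * s\<^sup>2 + 40 * s + 20)
        + k\<^sup>2 * (8 * s\<^sup>2 + 16 * s + 10) + k ^ 3 * (s + 1)"
      unfolding \<sigma> m by (simp add: power2_eq_square power3_eq_cube power4_eq_xxxx algebra_simps)
    also have "\<dots> > 0" using sk by (intro add_pos_nonneg add_nonneg_pos mult_nonneg_nonneg) auto
    finally show ?thesis .
  qed
  have top: "0 < ?c + \<sigma> * ?k"
  proof -
    have "?c + \<sigma> * ?k = 3 * s ^ 4 + 19 * s ^ 3 + 42 * s\<^sup>2 + 38 * s + 12
        + k * (19 * s ^ 3 + 59 * s\<^sup>2 + 60 * s + 20)
        + k\<^sup>2 * (9 * s\<^sup>2 + 19 * s + 10) + k ^ 3 * (s + 1)"
      unfolding \<sigma> m by (simp add: power2_eq_square power3_eq_cube power4_eq_xxxx algebra_simps)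
    also have "\<dots> > 0" using sk by (intro add_pos_nonneg add_nonneg_pos mult_nonneg_nonneg) auto
    finally show ?thesis .
  qed
  show ?thesis
  proof (cases "0 \<le> ?k")
    case True
    then show ?thesis using one mult_right_mono[OF \<epsilon> True] by linarith
  next
    case False
    then show ?thesis using top mult_right_mono_neg[OF \<open>\<epsilon> \<le> \<sigma>\<close>, of ?k] by linarith
  qed
qed

text \<open>
In the application \<open>\<sigma> + 1 = |S|\<close>, \<open>q = d - \<beta>\<close>, and \<open>b\<close> is the mean number of neighbours of a vertex of \<open>S\<close>
in \<open>B\<close>. The summands on the right are the Cauchy-Schwarz bounds on the second moment contributed by \<open>x\<close>,
by the second sphere of \<open>x\<close>, by \<open>\<Delta>\<close>, by \<open>A\<close> and by the neighbours of \<open>S\<close> in \<open>B\<close>; the left-hand side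
is the upper bound for the second moment, all divided by \<open>|S|\<^sup>2\<close>.

The right-hand side is a convex quadratic in \<open>b\<close>. Each square is replaced by a tangent line; the slopes
come from the densities \<open>l\<close> on the large blocks and \<open>r\<close> on the block of size \<open>\<sigma>\<close>, which are optimal for
\<open>\<epsilon> = 0\<close> up to lower order terms. They satisfy \<open>6 l + 2 r = 4\<close>, so that \<open>b\<close> cancels from
the sum of the tangents for every \<open>\<epsilon>\<close>.
\<close>
lemma density_inequality:
  fixes m q \<beta> \<alpha> \<epsilon> \<sigma> b :: real
  assumes m: "m = q + \<epsilon>" and \<alpha>: "\<alpha> = \<beta> - 1 - \<epsilon>" and q: "q \<le> \<beta>"
    and \<sigma>: "1 \<le> \<sigma>" "2 * \<sigma> + 1 \<le> m" and b: "\<epsilon> \<le> b" "b \<le> \<sigma>"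
    and \<epsilon>: "1 \<le> \<epsilon> \<or> \<epsilon> = 0 \<and> 7 \<le> m"
  shows "\<beta> + q / (\<sigma> + 1)
    < 1 + (m - b)\<^sup>2 * \<beta> / (m * q) + (\<beta> - 1 - b)\<^sup>2 / \<alpha> + (b - \<epsilon>)\<^sup>2 / m + b\<^sup>2 / \<sigma>"
proof -
  define T where "T = 3 * \<sigma> + m"
  define l r where "l = 2 * \<sigma> / T" and "r = 2 * m / T"
  define x where "x = b - \<epsilon>"
  have pos: "0 < m" "0 < T" "0 < q" "0 \<le> \<epsilon>" "0 \<le> x"
    using assms by (auto simp: T_def x_def)
  have x2: "2 * x \<le> \<alpha>" using assms by (auto simp: x_def)
  have lr: "6 * l + 2 * r = 4"
  proof -
    have "6 * l + 2 * r = 4 * T / T" by (simp add: l_def r_def T_def add_divide_distrib)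
    then show ?thesis using pos by simp
  qed
  \<comment> \<open>This block has size \<open>m q / \<beta>\<close>. Keeping \<open>l\<^sup>2 (\<beta> - q)\<close> from it offsets the growth of the block \<open>\<alpha>\<close> with \<open>\<beta>\<close>,
     so that the inequality reduces to the case \<open>\<beta> = q\<close>.\<close>
  have tangent_R: "(m - b)\<^sup>2 / m + l\<^sup>2 * (\<beta> - q) \<le> (m - b)\<^sup>2 * \<beta> / (m * q)"
  proof -
    have "l \<le> 1 / 2" "0 \<le> l" using \<sigma> pos by (auto simp: l_def T_def field_simps)
    then have "l\<^sup>2 \<le> (1 / 2)\<^sup>2" by (intro power_mono)
    moreover have "(m / 2)\<^sup>2 \<le> (m - b)\<^sup>2" using assms by (intro power_mono) auto
    moreover have "l\<^sup>2 * (m * q) \<le> (1 / 2)\<^sup>2 * (m * m)"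
      using calculation pos m by (intro mult_mono) auto
    ultimately have "l\<^sup>2 * (m * q) \<le> (m - b)\<^sup>2"
      by (simp add: power2_eq_square)
    then have "l\<^sup>2 \<le> (m - b)\<^sup>2 / (m * q)" using pos by (simp add: pos_le_divide_eq)
    then have "l\<^sup>2 * (\<beta> - q) \<le> (m - b)\<^sup>2 / (m * q) * (\<beta> - q)"
      using q by (intro mult_right_mono) auto
    also have "\<dots> = (m - b)\<^sup>2 * \<beta> / (m * q) - (m - b)\<^sup>2 / m"
      using pos by (simp add: field_simps)
    finally show ?thesis by simp
  qed
  \<comment> \<open>If \<open>\<alpha> = 0\<close> then \<open>x = 0\<close>, and the quotients with denominator \<open>0\<close> have the intended value \<open>0\<close>.\<close>
  have tangent_D: "\<alpha> - 2 * x + (2 * l * x - l\<^sup>2 * \<alpha>) \<le> (\<beta> - 1 - b)\<^sup>2 / \<alpha>"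
  proof -
    have "(\<beta> - 1 - b)\<^sup>2 / \<alpha> = \<alpha> - 2 * x + x\<^sup>2 / \<alpha>"
      using x2 pos \<alpha> by (cases "\<alpha> = 0") (auto simp: x_def field_simps power2_eq_square)
    then show ?thesis using square_div_ge_tangent[of \<alpha> x l] x2 pos by auto
  qed
  have tangent_B: "2 * r * b - r\<^sup>2 * \<sigma> \<le> b\<^sup>2 / \<sigma>"
    using \<sigma> by (intro square_div_ge_tangent) auto
  \<comment> \<open>Two blocks of equal size with means \<open>b\<close> and \<open>x = b - \<epsilon>\<close>: a common tangent at the midpoint, plus the
     spread \<open>\<epsilon>\<^sup>2 / (2 m)\<close>, without which the tangents do not suffice at \<open>\<epsilon> = 1\<close>, \<open>\<sigma> = 2\<close>, \<open>m = 5\<close>.\<close>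
  have tangent_A: "4 * l * (x + \<epsilon> / 2) - 2 * l\<^sup>2 * m + \<epsilon>\<^sup>2 / (2 * m) \<le> b\<^sup>2 / m + x\<^sup>2 / m"
  proof -
    have "b\<^sup>2 / m + x\<^sup>2 / m = 2 * ((x + \<epsilon> / 2)\<^sup>2 / m) + \<epsilon>\<^sup>2 / (2 * m)"
      using pos by (simp add: x_def field_simps power2_eq_square)
    then show ?thesis using square_div_ge_tangent[of m "x + \<epsilon> / 2" l] pos by simp
  qed
  \<comment> \<open>A lower bound for the spread that is linear in \<open>\<epsilon>\<close> and has the denominator of \<open>l\<^sup>2\<close>.\<close>
  have gain: "6 * \<epsilon> * \<sigma> / T\<^sup>2 \<le> \<epsilon>\<^sup>2 / (2 * m)"
  proof -
    have "\<epsilon> \<le> \<epsilon>\<^sup>2" using \<epsilon> by (auto simp: power2_eq_square)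
    moreover have "12 * \<sigma> * m \<le> T\<^sup>2"
      using zero_le_power2[of "3 * \<sigma> - m"] by (simp add: T_def power2_eq_square algebra_simps)
    ultimately have "\<epsilon> * (12 * \<sigma> * m) \<le> \<epsilon>\<^sup>2 * T\<^sup>2"
      using \<sigma> pos by (intro mult_mono) auto
    then show ?thesis using pos by (simp add: field_simps)
  qed
  define F where "F = m * \<sigma> * T * (m - \<sigma> - 4) + 4 * \<sigma>\<^sup>2 * (\<sigma> + 1)
           + \<epsilon> * ((m\<^sup>2 - 2 * \<sigma> * m - 7 * \<sigma>\<^sup>2) * (\<sigma> + 1) + T\<^sup>2 + 6 * \<sigma> * (\<sigma> + 1))"
  have "0 < F" unfolding F_def T_def
    using residual_polynomial_pos[of \<sigma> m \<epsilon>] assms by auto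
  then have "0 < F / (T\<^sup>2 * (\<sigma> + 1))" using pos \<sigma> by simp
  also have "\<dots> = m + \<epsilon> - 4 * l * \<epsilon> + l\<^sup>2 * (1 + 2 * \<epsilon> - 3 * m) - r\<^sup>2 * \<sigma>
      + 6 * \<epsilon> * \<sigma> / T\<^sup>2 - q / (\<sigma> + 1)"
  proof -
    have s1: "\<sigma> + 1 \<noteq> 0" using \<sigma> by simp
    have q': "q = m - \<epsilon>" using m by simp
    define g p where "g = 6 * \<epsilon> * \<sigma> / T\<^sup>2" and "p = q / (\<sigma> + 1)"
    have cleared: "l * T = 2 * \<sigma>" "r * T = 2 * m" "g * T\<^sup>2 = 6 * \<epsilon> * \<sigma>" "p * (\<sigma> + 1) = q"
      using pos s1 by (auto simp: l_def r_def g_def p_def)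
    have "(m + \<epsilon> - 4 * l * \<epsilon> + l\<^sup>2 * (1 + 2 * \<epsilon> - 3 * m) - r\<^sup>2 * \<sigma> + g - p) * (T\<^sup>2 * (\<sigma> + 1))
      = ((m + \<epsilon>) * T\<^sup>2 - 4 * (l * T) * \<epsilon> * T + (l * T)\<^sup>2 * (1 + 2 * \<epsilon> - 3 * m) - (r * T)\<^sup>2 * \<sigma>
        + g * T\<^sup>2) * (\<sigma> + 1) - p * (\<sigma> + 1) * T\<^sup>2"
      by (simp add: power2_eq_square algebra_simps)
    also have "\<dots> = F"
      unfolding cleared by (simp add: F_def T_def q' power2_eq_square algebra_simps)
    finally have "F / (T\<^sup>2 * (\<sigma> + 1))
      = m + \<epsilon> - 4 * l * \<epsilon> + l\<^sup>2 * (1 + 2 * \<epsilon> - 3 * m) - r\<^sup>2 * \<sigma> + g - p"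
      using pos s1 by (subst divide_eq_eq) auto
    then show ?thesis by (simp only: g_def p_def)
  qed
  finally have *: "0 < \<dots>" .
  have "(6 * l + 2 * r) * b = 4 * b" by (simp add: lr)
  moreover have "(m - b)\<^sup>2 / m = m - 2 * b + b\<^sup>2 / m"
    using pos by (simp add: field_simps power2_eq_square)
  ultimately show ?thesis
    using * tangent_R tangent_D tangent_B tangent_A gain
    unfolding x_def m \<alpha> by (simp add: algebra_simps)
qed

section \<open>Hall's theorem\<close>

text \<open>
The Halmos-Vaughan induction. If some proper nonempty subfamily \<open>J\<close> is tight, it is matched into its own
union, and the other sets still satisfy Hall's condition after that union has been removed. If no such
subfamily is tight, any value may be assigned to any one index, because removing a single point
costs each union at most one element.
\<close>
theorem hall_marriage:
  fixes F :: "'i \<Rightarrow> 'b set"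
  assumes "finite I" and "\<And>i. i \<in> I \<Longrightarrow> finite (F i)"
    and "\<And>J. J \<subseteq> I \<Longrightarrow> card J \<le> card (\<Union>(F ` J))"
  shows "\<exists>f. inj_on f I \<and> (\<forall>i\<in>I. f i \<in> F i)"
  using assms
proof (induction "card I" arbitrary: I F rule: less_induct)
  case less
  note finI = less.prems(1) and finF = less.prems(2) and hall = less.prems(3)
  have finU: "finite (\<Union>(F ` J))" if "J \<subseteq> I" for J
    using that finI finF by (auto intro: finite_subset)
  show ?case
  proof (cases "I = {}")
    case False
    then obtain i where i: "i \<in> I" by blast
    show ?thesis
    proof (cases "\<exists>J. J \<subset> I \<and> J \<noteq> {} \<and> card (\<Union>(F ` J)) = card J")
      case True
      then obtain J where J: "J \<subset> I" "J \<noteq> {}" and tight: "card (\<Union>(F ` J)) = card J" by blast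
      define G where "G j = F j - \<Union>(F ` J)" for j
      have "card J < card I" using J finI by (simp add: psubset_card_mono)
      moreover have "finite J" using J finI by (auto intro: finite_subset)
      moreover have "finite (F j)" if "j \<in> J" for j using that J finF by blast
      moreover have "card K \<le> card (\<Union>(F ` K))" if "K \<subseteq> J" for K using that J by (intro hall) auto
      ultimately obtain f where f: "inj_on f J" "\<forall>j\<in>J. f j \<in> F j"
        using less.hyps[of J F] by blast
      have "card (I - J) < card I"
        using J finI by (intro psubset_card_mono) auto
      moreover have "card K \<le> card (\<Union>(G ` K))" if K: "K \<subseteq> I - J" for K
      proof -
        have "card K + card J = card (K \<union> J)"
          using K J finI by (intro card_Un_disjoint[symmetric]) (auto intro: finite_subset)
        also have "\<dots> \<le> card (\<Union>(F ` (K \<union> J)))" using K J by (intro hall) auto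
        also have "\<Union>(F ` (K \<union> J)) = \<Union>(G ` K) \<union> \<Union>(F ` J)" by (auto simp: G_def)
        also have "card \<dots> \<le> card (\<Union>(G ` K)) + card (\<Union>(F ` J))" by (rule card_Un_le)
        finally show ?thesis using tight by simp
      qed
      moreover have "finite (G j)" if "j \<in> I - J" for j using that finF by (auto simp: G_def)
      ultimately obtain g where g: "inj_on g (I - J)" "\<forall>j\<in>I - J. g j \<in> G j"
        using less.hyps[of "I - J" G] finI by blast
      define h where "h = (\<lambda>j. if j \<in> J then f j else g j)"
      have "f ` J \<inter> g ` (I - J) = {}" using f(2) g(2) by (fastforce simp: G_def)
      then have "inj_on h (J \<union> (I - J))"
        unfolding h_def by (rule inj_on_disjoint_Un[OF f(1) g(1)])
      moreover have "J \<union> (I - J) = I" using J by blast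
      moreover have "\<forall>j\<in>I. h j \<in> F j" using f(2) g(2) by (simp add: h_def G_def)
      ultimately show ?thesis by auto
    next
      case False
      then have slack: "card J < card (\<Union>(F ` J))" if "J \<subset> I" "J \<noteq> {}" for J
        using that hall[of J] by (metis le_neq_implies_less psubset_imp_subset)
      have "F i \<noteq> {}" using hall[of "{i}"] i by auto
      then obtain b where b: "b \<in> F i" by blast
      define G where "G j = F j - {b}" for j
      have "card (I - {i}) < card I" using i finI by (intro psubset_card_mono) auto
      moreover have "card K \<le> card (\<Union>(G ` K))" if K: "K \<subseteq> I - {i}" for K
      proof (cases "K = {}")
        case False
        then have "card K < card (\<Union>(F ` K))" using K i by (intro slack) auto
        moreover have "\<Union>(G ` K) = \<Union>(F ` K) - {b}" by (auto simp: G_def)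
        ultimately show ?thesis using finU[of K] K by (auto simp: card_Diff_singleton_if)
      qed simp
      moreover have "finite (G j)" if "j \<in> I - {i}" for j using that finF by (auto simp: G_def)
      ultimately obtain g where g: "inj_on g (I - {i})" "\<forall>j\<in>I - {i}. g j \<in> G j"
        using less.hyps[of "I - {i}" G] finI by blast
      define h where "h = g(i := b)"
      have "h j \<in> F j" if "j \<in> I" for j using that g b by (auto simp: h_def G_def)
      moreover have "inj_on h I"
        using g by (auto simp: h_def G_def inj_on_def)
      ultimately show ?thesis by blast
    qed
  qed simp
qed

section \<open>Counting in amply regular graphs\<close>

text \<open>
An amply regular graph given by its neighbourhood function. Two distinct nonadjacent vertices have
distance \<open>2\<close> exactly if they have a common neighbour, so that the path metric does not enter the counting.
\<close>
locale amply_regular_neighbourhoods =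
  fixes V :: "'a set" and N :: "'a \<Rightarrow> 'a set" and d \<alpha> \<beta> :: nat
  assumes finite_V: "finite V"
    and N_subset: "N x \<subseteq> V"
    and N_sym: "y \<in> N x \<Longrightarrow> x \<in> N y"
    and N_irrefl: "x \<notin> N x"
    and degree: "x \<in> V \<Longrightarrow> card (N x) = d"
    and common_adjacent: "y \<in> N x \<Longrightarrow> card (N x \<inter> N y) = \<alpha>"
    and common_distance_2:
      "x \<noteq> y \<Longrightarrow> y \<notin> N x \<Longrightarrow> N x \<inter> N y \<noteq> {} \<Longrightarrow> card (N x \<inter> N y) = \<beta>"
begin

lemma finite_N [simp]: "finite (N x)"
  using N_subset finite_V by (rule finite_subset)

lemma in_V: "y \<in> N x \<Longrightarrow> x \<in> V" "y \<in> N x \<Longrightarrow> y \<in> V"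
  using N_subset N_sym by blast+

lemma edges_between_swap:
  assumes "finite S" "finite T"
  shows "(\<Sum>u\<in>S. card (N u \<inter> T)) = (\<Sum>w\<in>T. card (N w \<inter> S))"
proof -
  have "card (N u \<inter> T) = (\<Sum>w\<in>T. if w \<in> N u then 1 else 0)" for u
    using assms by (simp add: sum.If_cases Int_commute)
  moreover have "card (N w \<inter> S) = (\<Sum>u\<in>S. if w \<in> N u then 1 else 0)" for w
  proof -
    have "S \<inter> {u. w \<in> N u} = N w \<inter> S" using N_sym by blast
    then show ?thesis using assms by (simp add: sum.If_cases)
  qed
  ultimately show ?thesis by (simp add: sum.swap[of _ S])
qed

text \<open>
The left-hand side counts the pairs in \<open>S \<times> S\<close> together with a common neighbour. A pair of equal vertices
has \<open>d\<close> of them, any other pair \<open>\<alpha>\<close>, \<open>\<beta>\<close> or \<open>0\<close>.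
\<close>
lemma second_moment_le:
  assumes "S \<subseteq> V" and "\<alpha> \<le> \<beta>"
  shows "(\<Sum>w\<in>V. (card (N w \<inter> S))\<^sup>2) \<le> card S * (d + (card S - 1) * \<beta>)"
proof -
  have finS: "finite S" using assms finite_V by (rule_tac finite_subset)
  have "(card (N w \<inter> S))\<^sup>2 = (\<Sum>u\<in>N w \<inter> S. card (N w \<inter> S))" for w
    by (simp add: power2_eq_square)
  also have "(\<Sum>u\<in>N w \<inter> S. card (N w \<inter> S)) = (\<Sum>u\<in>S. if w \<in> N u then card (N w \<inter> S) else 0)" for w
  proof -
    have "S \<inter> {u. w \<in> N u} = N w \<inter> S" using N_sym by blast
    then show ?thesis using finS by (simp add: sum.If_cases)
  qed
  finally have "(\<Sum>w\<in>V. (card (N w \<inter> S))\<^sup>2) = (\<Sum>u\<in>S. \<Sum>w\<in>V. if w \<in> N u then card (N w \<inter> S) else 0)"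
    by (simp add: sum.swap[of _ S])
  also have "\<dots> = (\<Sum>u\<in>S. \<Sum>w\<in>N u. card (N w \<inter> S))"
  proof (rule sum.cong[OF refl])
    fix u
    have "V \<inter> {w. w \<in> N u} = N u" using N_subset by blast
    then show "(\<Sum>w\<in>V. if w \<in> N u then card (N w \<inter> S) else 0) = (\<Sum>w\<in>N u. card (N w \<inter> S))"
      using finite_V by (simp add: sum.If_cases)
  qed
  also have "\<dots> = (\<Sum>u\<in>S. \<Sum>v\<in>S. card (N v \<inter> N u))"
    using finS by (simp add: edges_between_swap)
  also have "\<dots> \<le> (\<Sum>u\<in>S. d + (card S - 1) * \<beta>)"
  proof (rule sum_mono)
    fix u assume u: "u \<in> S"
    have "card (N v \<inter> N u) \<le> \<beta>" if "v \<noteq> u" for v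
      using that common_adjacent[of v u] common_distance_2[of u v] \<open>\<alpha> \<le> \<beta>\<close>
      by (cases "v \<in> N u"; cases "N u \<inter> N v = {}") (auto simp: Int_commute)
    then have "(\<Sum>v\<in>S - {u}. card (N v \<inter> N u)) \<le> (\<Sum>v\<in>S - {u}. \<beta>)"
      by (intro sum_mono) auto
    moreover have "(\<Sum>v\<in>S. card (N v \<inter> N u)) = d + (\<Sum>v\<in>S - {u}. card (N v \<inter> N u))"
      using u finS degree[of u] assms by (subst sum.remove[of S u]) auto
    ultimately show "(\<Sum>v\<in>S. card (N v \<inter> N u)) \<le> d + (card S - 1) * \<beta>"
      using u finS by simp
  qed
  finally show ?thesis by simp
qed

text \<open>
For empty \<open>W\<close> both sides are \<open>0\<close>, since division by \<open>0\<close> yields \<open>0\<close>.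
\<close>
lemma cauchy_schwarz_edges:
  "(\<Sum>w\<in>W. real (card (N w \<inter> S)))\<^sup>2 / card W \<le> (\<Sum>w\<in>W. (real (card (N w \<inter> S)))\<^sup>2)"
proof (cases "card W = 0")
  case False
  then show ?thesis
    using sum_squared_le_sum_of_squares[of "\<lambda>w. real (card (N w \<inter> S))" W]
    by (simp add: pos_divide_le_eq)
qed (simp add: sum_nonneg)

definition exclusive :: "'a \<Rightarrow> 'a \<Rightarrow> 'a set" where
  "exclusive x y = N x - N y - {y}"

definition second_sphere :: "'a \<Rightarrow> 'a set" where
  "second_sphere x = {w \<in> V. w \<noteq> x \<and> w \<notin> N x \<and> N x \<inter> N w \<noteq> {}}"

lemma exclusive_subset: "exclusive x y \<subseteq> V"
  using N_subset by (auto simp: exclusive_def)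

lemma second_sphere_subset: "second_sphere x \<subseteq> V"
  by (auto simp: second_sphere_def)

lemma finite_exclusive [simp]: "finite (exclusive x y)"
  by (simp add: exclusive_def)

lemma finite_second_sphere [simp]: "finite (second_sphere x)"
  using second_sphere_subset finite_V by (rule finite_subset)

lemma card_exclusive:
  assumes "y \<in> N x"
  shows "card (exclusive x y) + \<alpha> + 1 = d"
proof -
  have "N x = insert y (exclusive x y \<union> (N x \<inter> N y))"
    using assms N_irrefl by (auto simp: exclusive_def)
  then have "card (N x) = card (insert y (exclusive x y \<union> (N x \<inter> N y)))" by simp
  also have "\<dots> = Suc (card (exclusive x y \<union> (N x \<inter> N y)))"
    using N_irrefl by (subst card_insert_disjoint) (auto simp: exclusive_def)
  also have "\<dots> = Suc (card (exclusive x y) + \<alpha>)"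
    using common_adjacent[OF assms] by (subst card_Un_disjoint) (auto simp: exclusive_def)
  finally show ?thesis using degree in_V(1)[OF assms] by simp
qed

lemma exclusive_swap_subset_second_sphere:
  assumes "y \<in> N x"
  shows "exclusive y x \<subseteq> second_sphere x"
  using assms N_sym N_subset unfolding exclusive_def second_sphere_def by blast

text \<open>
Double counting of the edges between \<open>N x\<close> and the second sphere: every \<open>z \<in> N x\<close> sends there its
neighbours that are neither \<open>x\<close> nor common neighbours of \<open>x\<close> and \<open>z\<close>, and every vertex of the second sphere
receives \<open>\<beta>\<close> edges.
\<close>
lemma card_second_sphere:
  assumes "y \<in> N x"
  shows "\<beta> * card (second_sphere x) = d * card (exclusive x y)"
proof -
  have "(\<Sum>z\<in>N x. card (N z \<inter> second_sphere x)) = (\<Sum>w\<in>second_sphere x. card (N w \<inter> N x))"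
    by (simp add: edges_between_swap)
  also have "\<dots> = (\<Sum>w\<in>second_sphere x. \<beta>)"
  proof (rule sum.cong[OF refl])
    fix w assume "w \<in> second_sphere x"
    then have "card (N x \<inter> N w) = \<beta>"
      by (intro common_distance_2) (auto simp: second_sphere_def)
    then show "card (N w \<inter> N x) = \<beta>" by (simp add: Int_commute)
  qed
  also have "(\<Sum>z\<in>N x. card (N z \<inter> second_sphere x)) = (\<Sum>z\<in>N x. card (exclusive x y))"
  proof (rule sum.cong[OF refl])
    fix z assume z: "z \<in> N x"
    have "N z \<inter> second_sphere x = exclusive z x"
      using z N_sym N_subset unfolding exclusive_def second_sphere_def by blast
    then show "card (N z \<inter> second_sphere x) = card (exclusive x y)"
      using card_exclusive[OF assms] card_exclusive[OF N_sym[OF z]] by simp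
  qed
  finally show ?thesis using degree in_V(1)[OF assms] by simp
qed

lemma card_first_spheres_le:
  assumes "x \<in> V"
  shows "1 + d + card (second_sphere x) \<le> card V"
proof -
  have "1 + d + card (second_sphere x) = card (insert x (N x \<union> second_sphere x))"
    using N_irrefl degree[OF assms]
    by (subst card_insert_disjoint; (subst card_Un_disjoint)?) (auto simp: second_sphere_def finite_V)
  also have "\<dots> \<le> card V"
    using assms N_subset by (intro card_mono finite_V) (auto simp: second_sphere_def)
  finally show ?thesis .
qed

text \<open>
The next three lemmas describe where a vertex \<open>u\<close> of \<open>A\<close> has its neighbours. They come from counting the
common neighbours of \<open>u\<close> and \<open>y\<close>, those of \<open>u\<close> and \<open>x\<close>, and the neighbours of \<open>u\<close> at distance \<open>2\<close> from \<open>x\<close>.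
Together they express all the degrees of \<open>u\<close> into the blocks through its degree into \<open>B\<close>.
\<close>
lemma degree_in_common:
  assumes "y \<in> N x" "u \<in> exclusive x y"
  shows "card (N u \<inter> (N x \<inter> N y)) + card (N u \<inter> exclusive y x) + 1 = \<beta>"
proof -
  have u: "u \<in> N x" "u \<notin> N y" "u \<noteq> y" using assms by (auto simp: exclusive_def)
  have "card (N u \<inter> N y) = \<beta>"
    using u assms N_sym by (intro common_distance_2) blast+
  moreover have "N u \<inter> N y = insert x ((N u \<inter> (N x \<inter> N y)) \<union> (N u \<inter> exclusive y x))"
    using u assms N_sym by (auto simp: exclusive_def)
  moreover have "card \<dots> = 1 + (card (N u \<inter> (N x \<inter> N y)) + card (N u \<inter> exclusive y x))"
    using N_irrefl
    by (subst card_insert_disjoint; (subst card_Un_disjoint)?) (auto simp: exclusive_def)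
  ultimately show ?thesis by simp
qed

lemma degree_in_own_side:
  assumes "y \<in> N x" "u \<in> exclusive x y"
  shows "card (N u \<inter> (N x \<inter> N y)) + card (N u \<inter> exclusive x y) = \<alpha>"
proof -
  have u: "u \<in> N x" "u \<notin> N y" "u \<noteq> y" using assms by (auto simp: exclusive_def)
  have "N x \<inter> N u = (N u \<inter> (N x \<inter> N y)) \<union> (N u \<inter> exclusive x y)"
    using u assms N_sym by (auto simp: exclusive_def)
  then have "\<alpha> = card \<dots>" using common_adjacent[OF u(1)] by simp
  also have "\<dots> = card (N u \<inter> (N x \<inter> N y)) + card (N u \<inter> exclusive x y)"
    by (subst card_Un_disjoint) (auto simp: exclusive_def)
  finally show ?thesis by simp
qed

lemma degree_outside:
  assumes "y \<in> N x" "u \<in> exclusive x y"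
  shows "card (N u \<inter> (second_sphere x - exclusive y x)) + card (N u \<inter> exclusive y x)
       = card (exclusive x y)"
proof -
  have u: "u \<in> N x" using assms by (auto simp: exclusive_def)
  have "exclusive u x = (N u \<inter> (second_sphere x - exclusive y x)) \<union> (N u \<inter> exclusive y x)"
    using u assms(1) N_sym N_subset unfolding exclusive_def second_sphere_def by blast
  then have "card (exclusive u x) = card \<dots>" by simp
  also have "\<dots> = card (N u \<inter> (second_sphere x - exclusive y x)) + card (N u \<inter> exclusive y x)"
    by (subst card_Un_disjoint) (auto simp: exclusive_def)
  finally show ?thesis
    using card_exclusive[OF assms(1)] card_exclusive[OF N_sym[OF u]] by simp
qed

section \<open>Sets violating the condition of Hall\<close>

lemma card_split_at_edge:
  assumes "y \<in> N x" "W \<subseteq> V"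
  shows "card W = card (W \<inter> {x, y}) + card (W \<inter> (N x \<inter> N y)) + card (W \<inter> exclusive x y)
    + card (W \<inter> exclusive y x) + card (W - N x - N y)"
proof -
  have fin: "finite W" using assms finite_V by (rule_tac finite_subset)
  have "W = (((W \<inter> {x, y} \<union> W \<inter> (N x \<inter> N y)) \<union> W \<inter> exclusive x y) \<union> W \<inter> exclusive y x)
      \<union> (W - N x - N y)"
    by (auto simp: exclusive_def)
  also have "card \<dots> = card (W \<inter> {x, y}) + card (W \<inter> (N x \<inter> N y)) + card (W \<inter> exclusive x y)
    + card (W \<inter> exclusive y x) + card (W - N x - N y)"
    using fin assms N_sym N_irrefl
    by (subst card_Un_disjoint, simp, simp, fastforce simp: exclusive_def)+ simp
  finally show ?thesis .
qed

text \<open>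
The bound on the number of vertices leaves room for at most \<open>2 m\<close> vertices in the second sphere of \<open>x\<close>,
which has \<open>d m / \<beta>\<close> elements.
\<close>
lemma degree_le_twice_beta:
  assumes "y \<in> N x" "card V + 2 * \<alpha> < 3 * d" "exclusive x y \<noteq> {}"
  shows "d \<le> 2 * \<beta>"
proof -
  let ?m = "card (exclusive x y)"
  have "card (second_sphere x) \<le> 2 * ?m"
    using card_first_spheres_le[OF in_V(1)[OF assms(1)]] card_exclusive[OF assms(1)] assms(2) by linarith
  then have "\<beta> * card (second_sphere x) \<le> \<beta> * (2 * ?m)" by (rule mult_le_mono2)
  then have "d * ?m \<le> (2 * \<beta>) * ?m" using card_second_sphere[OF assms(1)]
    by (simp only: mult.assoc mult.left_commute)
  moreover have "0 < ?m" using assms(3) by (simp add: card_gt_0_iff)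
  ultimately show ?thesis by (meson mult_le_cancel2)
qed

text \<open>
A vertex \<open>u \<in> A\<close> without neighbours in \<open>B\<close> would force \<open>d = 2 \<beta>\<close> and make \<open>u\<close> adjacent to \<open>x\<close>, to all of
\<open>\<Delta>\<close> and to all of the set \<open>R\<close> of vertices adjacent to neither \<open>x\<close> nor \<open>y\<close>, and to nothing else. The
common neighbours of \<open>u\<close> with a vertex of \<open>\<Delta>\<close> then show that \<open>\<alpha>\<close> is odd, those with a vertex of \<open>B\<close> that
\<open>\<alpha>\<close> is even.
\<close>
lemma no_isolated_exclusive_neighbour:
  assumes xy: "y \<in> N x" and few: "card V + 2 * \<alpha> < 3 * d"
    and \<beta>: "\<beta> = \<alpha> + 1" and \<alpha>: "1 \<le> \<alpha>" and u: "u \<in> exclusive x y"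
  shows "N u \<inter> exclusive y x \<noteq> {}"
proof
  assume isolated: "N u \<inter> exclusive y x = {}"
  define m where "m = card (exclusive x y)"
  define R where "R = V - N x - N y"
  have yx: "x \<in> N y" using xy by (rule N_sym)
  have finR: "finite R" using finite_V by (simp add: R_def)
  have d: "d = m + \<alpha> + 1" using card_exclusive[OF xy] by (simp add: m_def)
  have m': "card (exclusive y x) = m" using card_exclusive[OF yx] d by simp
  have mpos: "0 < m" using u by (auto simp: m_def card_gt_0_iff)
  have d_le: "d \<le> 2 * \<beta>" using degree_le_twice_beta[OF xy few] u by blast
  have layer: "\<beta> * card (second_sphere x) = d * m" using card_second_sphere[OF xy] by (simp add: m_def)
  have sub: "second_sphere x - exclusive y x \<subseteq> R"
    by (auto simp: second_sphere_def exclusive_def R_def)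
  have outer: "card (N u \<inter> (second_sphere x - exclusive y x)) = m"
    using degree_outside[OF xy u] isolated by (simp add: m_def)
  \<comment> \<open>The neighbours of \<open>u\<close> alone need \<open>m\<close> vertices of the second sphere outside \<open>B\<close>, and \<open>B\<close> has \<open>m\<close> vertices:
     together with \<open>d \<le> 2 \<beta>\<close> every estimate is tight.\<close>
  have "m \<le> card (second_sphere x - exclusive y x)"
    using card_mono[of "second_sphere x - exclusive y x" "N u \<inter> (second_sphere x - exclusive y x)"] outer
    by simp
  also have "\<dots> = card (second_sphere x) - m"
    using exclusive_swap_subset_second_sphere[OF xy] m' by (simp add: card_Diff_subset)
  finally have "2 * m \<le> card (second_sphere x)" using mpos by linarith
  then have "\<beta> * (2 * m) \<le> d * m" using layer by (metis mult_le_mono2)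
  then have "(2 * \<beta>) * m \<le> d * m" by (simp add: algebra_simps)
  then have "2 * \<beta> \<le> d" using mpos by simp
  then have d2: "d = 2 * \<beta>" and mb: "m = \<alpha> + 1" using d_le d \<beta> by auto
  have "card R \<le> m"
  proof -
    have "card V = card (V \<inter> {x, y}) + card (V \<inter> (N x \<inter> N y)) + m + m + card R"
      using card_split_at_edge[OF xy order_refl] exclusive_subset m'
      by (simp add: R_def m_def Int_absorb1)
    moreover have "V \<inter> {x, y} = {x, y}" "V \<inter> (N x \<inter> N y) = N x \<inter> N y"
      using in_V[OF xy] N_subset by auto
    moreover have "x \<noteq> y" using xy N_irrefl by auto
    ultimately have "card V = 2 + \<alpha> + m + m + card R"
      using common_adjacent[OF xy] by simp
    then show ?thesis using few d by simp
  qed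
  moreover have "m \<le> card (N u \<inter> R)"
    using outer sub finR by (metis card_mono finite_Int inf_mono order_refl)
  ultimately have R_nbrs: "R \<subseteq> N u"
    using card_seteq[of R "N u \<inter> R"] finR by auto
  have "card (N u \<inter> (N x \<inter> N y)) = card (N x \<inter> N y)"
    using degree_in_common[OF xy u] isolated \<beta> common_adjacent[OF xy] by simp
  then have common_nbrs: "N x \<inter> N y \<subseteq> N u"
    using card_subset_eq[of "N x \<inter> N y" "N u \<inter> (N x \<inter> N y)"] by auto
  have "card (N u \<inter> exclusive x y) = 0"
    using degree_in_own_side[OF xy u] common_adjacent[OF xy] common_nbrs by (simp add: Int_absorb1)
  then have own: "N u \<inter> exclusive x y = {}" by simp
  have ux: "x \<in> N u" "y \<notin> N u" using u N_sym by (auto simp: exclusive_def)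
  have Nu: "N u = insert x ((N x \<inter> N y) \<union> R)"
    using R_nbrs common_nbrs own isolated ux N_subset[of u] by (auto simp: exclusive_def R_def)
  have "odd \<alpha>"
  proof -
    have "N x \<inter> N y \<noteq> {}" using common_adjacent[OF xy] \<alpha> by auto
    then obtain z where z: "z \<in> N x" "z \<in> N y" by blast
    define \<delta> where "\<delta> = card (N z \<inter> (N x \<inter> N y))"
    have zu: "z \<in> N u" using z common_nbrs by blast
    have "N u \<inter> N z = insert x ((N z \<inter> (N x \<inter> N y)) \<union> (N z - N x - N y))"
      unfolding Nu R_def using z N_sym N_subset by auto
    also have "card \<dots> = 1 + (\<delta> + card (N z - N x - N y))"
      using N_irrefl unfolding \<delta>_def
      by (subst card_insert_disjoint; (subst card_Un_disjoint)?) (use yx in auto)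
    finally have 1: "1 + (\<delta> + card (N z - N x - N y)) = \<alpha>" using common_adjacent[OF zu] by simp
    have "N x \<inter> N z = insert y ((N z \<inter> (N x \<inter> N y)) \<union> (N z \<inter> exclusive x y))"
      using z xy N_sym by (auto simp: exclusive_def)
    also have "card \<dots> = 1 + (\<delta> + card (N z \<inter> exclusive x y))"
      using N_irrefl unfolding \<delta>_def
      by (subst card_insert_disjoint; (subst card_Un_disjoint)?) (auto simp: exclusive_def)
    finally have 2: "1 + (\<delta> + card (N z \<inter> exclusive x y)) = \<alpha>" using common_adjacent[OF z(1)] by simp
    have "N y \<inter> N z = insert x ((N z \<inter> (N x \<inter> N y)) \<union> (N z \<inter> exclusive y x))"
      using z yx N_sym by (auto simp: exclusive_def)
    also have "card \<dots> = 1 + (\<delta> + card (N z \<inter> exclusive y x))"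
      using N_irrefl unfolding \<delta>_def
      by (subst card_insert_disjoint; (subst card_Un_disjoint)?) (auto simp: exclusive_def)
    finally have 3: "1 + (\<delta> + card (N z \<inter> exclusive y x)) = \<alpha>" using common_adjacent[OF z(2)] by simp
    have "N z \<inter> {x, y} = {x, y}" using z N_sym by blast
    moreover have "x \<noteq> y" using xy N_irrefl by auto
    ultimately have "d = 2 + \<delta> + card (N z \<inter> exclusive x y) + card (N z \<inter> exclusive y x)
        + card (N z - N x - N y)"
      using card_split_at_edge[OF xy N_subset[of z]] degree[of z] in_V(2)[OF z(1)]
      by (simp add: \<delta>_def)
    with 1 2 3 d2 \<beta> have "\<alpha> = 2 * \<delta> + 3" by linarith
    then show ?thesis by simp
  qed
  moreover have "even \<alpha>"
  proof -
    have "exclusive y x \<noteq> {}" using m' mpos by auto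
    then obtain v where v: "v \<in> exclusive y x" by blast
    then have v': "v \<in> N y" "v \<notin> N x" "v \<noteq> x" by (auto simp: exclusive_def)
    have vu: "v \<notin> N u" "u \<noteq> v" using v u isolated by (auto simp: exclusive_def)
    define k where "k = card (N v \<inter> exclusive x y)"
    have 1: "card (N v \<inter> (N x \<inter> N y)) + k = \<alpha>"
      using degree_in_common[OF yx v] \<beta> by (simp add: k_def Int_commute)
    have 2: "card (N v \<inter> (N x \<inter> N y)) + card (N v \<inter> exclusive y x) = \<alpha>"
      using degree_in_own_side[OF yx v] by (simp add: Int_commute)
    have "N v \<inter> {x, y} = {y}" using v' N_sym by blast
    then have "d = 1 + card (N v \<inter> (N x \<inter> N y)) + k + card (N v \<inter> exclusive y x)
        + card (N v - N x - N y)"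
      using card_split_at_edge[OF xy N_subset[of v]] degree[of v] in_V(2)[OF v'(1)]
      by (simp add: k_def)
    moreover have "N u \<inter> N v = (N v \<inter> (N x \<inter> N y)) \<union> (N v - N x - N y)"
      unfolding Nu R_def using v' N_sym N_subset by auto
    then have "card (N u \<inter> N v) = card (N v \<inter> (N x \<inter> N y)) + card (N v - N x - N y)"
      by (simp only:) (subst card_Un_disjoint; auto)
    ultimately have "card (N u \<inter> N v) + 2 * k = 2 * \<alpha> + 1"
      using 1 2 d2 \<beta> by linarith
    moreover from this have "card (N u \<inter> N v) \<noteq> 0" by presburger
    then have "card (N u \<inter> N v) = \<alpha> + 1"
      using common_distance_2[OF vu(2) vu(1)] \<beta> by auto
    ultimately show ?thesis by presburger
  qed
  ultimately show False by simp
qed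

text \<open>
A set \<open>S\<close> violating Hall's condition concentrates its edges into \<open>B\<close> on so few vertices that
\<open>second_moment_le\<close> fails for it. In the second case of the hypothesis on \<open>\<beta>\<close>, \<open>|S| = 1\<close> needs the parity argument;
if \<open>\<beta> \<ge> \<alpha> + 2\<close>, then every vertex of \<open>A\<close> has a neighbour in \<open>B\<close> and a deficient set has at least two
elements.
\<close>
lemma no_deficient_set:
  assumes xy: "y \<in> N x" and few: "card V + 2 * \<alpha> < 3 * d"
    and \<beta>: "\<alpha> + 2 \<le> \<beta> \<or> \<beta> = \<alpha> + 1 \<and> 7 \<le> card (exclusive x y)"
    and S: "S \<subseteq> exclusive x y" "S \<noteq> {}" and small: "2 * card S \<le> card (exclusive x y) + 1"
  shows "card S \<le> card {v \<in> exclusive y x. N v \<inter> S \<noteq> {}}" (is "_ \<le> card ?B")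
proof (rule ccontr)
  assume deficient: "\<not> ?thesis"
  define s m where "s = card S" and "m = card (exclusive x y)"
  define A B R \<Delta> where "A = exclusive x y" and "B = ?B"
    and "R = second_sphere x - exclusive y x" and "\<Delta> = N x \<inter> N y"
  define c where "c = (\<Sum>u\<in>S. card (N u \<inter> exclusive y x))"
  have yx: "x \<in> N y" using xy by (rule N_sym)
  have fin: "finite S" "finite A" "finite B" "finite R" "finite \<Delta>"
    using S finite_subset[OF S(1)] by (auto simp: A_def B_def R_def \<Delta>_def)
  have d: "d = m + \<alpha> + 1" using card_exclusive[OF xy] by (simp add: m_def)
  have m': "card (exclusive y x) = m" using card_exclusive[OF yx] d by simp
  have spos: "0 < s" using S fin by (simp add: s_def card_gt_0_iff)
  have Bs: "card B < s" using deficient by (simp add: B_def s_def)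
  have mpos: "0 < m" using S card_mono[OF _ S(1)] spos by (simp add: m_def s_def)
  have d_le: "d \<le> 2 * \<beta>" using degree_le_twice_beta[OF xy few] S by blast
  have deg_B: "card (N u \<inter> exclusive y x) \<le> card B" if "u \<in> S" for u
    using that N_sym by (intro card_mono fin) (auto simp: B_def)
  have c_le: "c \<le> s * (s - 1)"
  proof -
    have "c \<le> (\<Sum>u\<in>S. s - 1)" unfolding c_def
      using deg_B Bs by (intro sum_mono) fastforce
    then show ?thesis by (simp add: s_def)
  qed
  have deg_excess: "card (N u \<inter> A) + (\<beta> - \<alpha> - 1) = card (N u \<inter> exclusive y x)" if "u \<in> S" for u
    using degree_in_common[OF xy, of u] degree_in_own_side[OF xy, of u] that S \<beta>
    unfolding A_def by fastforce
  \<comment> \<open>The edges between \<open>S\<close> and each of the four blocks, all in terms of \<open>c\<close>.\<close>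
  have edges: "(\<Sum>w\<in>W. card (N w \<inter> S)) = (\<Sum>u\<in>S. card (N u \<inter> W))" if "finite W" for W
    using that fin by (simp add: edges_between_swap)
  have eB: "(\<Sum>w\<in>B. card (N w \<inter> S)) = c"
  proof -
    have "(\<Sum>w\<in>B. card (N w \<inter> S)) = (\<Sum>w\<in>exclusive y x. card (N w \<inter> S))"
      by (rule sum.mono_neutral_left) (auto simp: B_def)
    then show ?thesis by (simp add: c_def edges)
  qed
  have eA: "(\<Sum>w\<in>A. card (N w \<inter> S)) + s * (\<beta> - \<alpha> - 1) = c"
  proof -
    have "c = (\<Sum>u\<in>S. card (N u \<inter> A) + (\<beta> - \<alpha> - 1))"
      unfolding c_def by (rule sum.cong[OF refl]) (rule deg_excess[symmetric])
    then show ?thesis using fin by (simp add: edges sum.distrib s_def)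
  qed
  have eD: "(\<Sum>w\<in>\<Delta>. card (N w \<inter> S)) + c + s = s * \<beta>"
  proof -
    have "(\<Sum>u\<in>S. card (N u \<inter> \<Delta>) + card (N u \<inter> exclusive y x) + 1) = (\<Sum>u\<in>S. \<beta>)"
      unfolding \<Delta>_def using degree_in_common[OF xy] S by (intro sum.cong) auto
    then have "s * \<beta> = (\<Sum>u\<in>S. card (N u \<inter> \<Delta>) + card (N u \<inter> exclusive y x) + 1)"
      by (simp only: sum_constant s_def of_nat_id)
    then show ?thesis using fin by (simp add: edges sum_Suc sum.distrib c_def s_def)
  qed
  have eR: "(\<Sum>w\<in>R. card (N w \<inter> S)) + c = s * m"
  proof -
    have "(\<Sum>u\<in>S. card (N u \<inter> R) + card (N u \<inter> exclusive y x)) = (\<Sum>u\<in>S. m)"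
      unfolding R_def m_def using degree_outside[OF xy] S by (intro sum.cong) auto
    then have "s * m = (\<Sum>u\<in>S. card (N u \<inter> R) + card (N u \<inter> exclusive y x))"
      by (simp only: sum_constant s_def of_nat_id)
    then show ?thesis using fin by (simp add: edges sum.distrib c_def)
  qed
  have disj: "x \<notin> R \<union> \<Delta> \<union> A \<union> B" "R \<inter> \<Delta> = {}" "(R \<union> \<Delta>) \<inter> A = {}" "(R \<union> \<Delta> \<union> A) \<inter> B = {}"
    using N_irrefl by (auto simp: R_def \<Delta>_def A_def B_def exclusive_def second_sphere_def)
  \<comment> \<open>The blocks are disjoint, and \<open>x\<close>, which is adjacent to all of \<open>S\<close>, lies outside them.\<close>
  define f where "f w = (real (card (N w \<inter> S)))\<^sup>2" for w
  have "N x \<inter> S = S" using S by (auto simp: exclusive_def)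
  then have "(real s)\<^sup>2 + (sum f R + sum f \<Delta> + sum f A + sum f B) = sum f (insert x (R \<union> \<Delta> \<union> A \<union> B))"
    using fin disj by (simp add: sum.union_disjoint f_def s_def)
  also have "\<dots> \<le> sum f V"
    using in_V[OF xy] second_sphere_subset[of x] exclusive_subset[of x y] exclusive_subset[of y x]
      N_subset[of x] finite_V
    by (intro sum_mono2) (auto simp: f_def R_def \<Delta>_def A_def B_def)
  also have "\<dots> \<le> real s * (real d + (real s - 1) * real \<beta>)"
  proof -
    have "(\<Sum>w\<in>V. (card (N w \<inter> S))\<^sup>2) \<le> s * (d + (s - 1) * \<beta>)"
      unfolding s_def using S exclusive_subset \<beta> by (intro second_moment_le) auto
    then have "real (\<Sum>w\<in>V. (card (N w \<inter> S))\<^sup>2) \<le> real (s * (d + (s - 1) * \<beta>))"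
      by (rule of_nat_mono)
    then show ?thesis using spos by (simp add: f_def of_nat_diff)
  qed
  finally have moment: "(real s)\<^sup>2 + (sum f R + sum f \<Delta> + sum f A + sum f B)
      \<le> real s * (real d + (real s - 1) * real \<beta>)" .
  show False
  proof (cases "s = 1")
    case True
    then have "c = 0" using c_le by simp
    then have zero: "N u \<inter> exclusive y x = {}" if "u \<in> S" for u
      using that fin by (simp add: c_def)
    obtain u where u: "u \<in> S" using S by blast
    have "\<beta> - \<alpha> - 1 = 0" using deg_excess[OF u] zero[OF u] by simp
    then have \<beta>1: "\<beta> = \<alpha> + 1" and "7 \<le> m" using \<beta> by (auto simp: m_def)
    then have "1 \<le> \<alpha>" using d_le d by simp
    with no_isolated_exclusive_neighbour[OF xy few \<beta>1 _ subsetD[OF S(1) u]] zero[OF u]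
    show False by blast
  next
    case False
    \<comment> \<open>Division of the second moment inequality by \<open>s\<^sup>2\<close> leads to the situation of \<open>density_inequality\<close>.\<close>
    define q \<epsilon> \<sigma> b where "q = real d - real \<beta>" and "\<epsilon> = real \<beta> - real \<alpha> - 1"
      and "\<sigma> = real s - 1" and "b = real c / real s"
    have sb: "real s * b = real c" using spos by (simp add: b_def)
    have s2: "2 \<le> s" using False spos by simp
    have mq: "real m = q + \<epsilon>" using d by (simp add: q_def \<epsilon>_def)
    have \<epsilon>_nat: "\<epsilon> = real (\<beta> - \<alpha> - 1)" using \<beta> by (auto simp: \<epsilon>_def)
    have "real s * \<epsilon> \<le> real c" unfolding \<epsilon>_nat using eA by (metis le_add2 of_nat_le_iff of_nat_mult)
    then have b1: "\<epsilon> \<le> b" using spos by (simp add: b_def pos_le_divide_eq mult.commute)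
    have "real c \<le> real s * \<sigma>"
      using of_nat_mono[OF c_le, where ?'a = real] spos by (simp add: \<sigma>_def of_nat_diff)
    then have b2: "b \<le> \<sigma>" using spos by (simp add: b_def pos_divide_le_eq mult.commute)
    have \<sigma>: "1 \<le> \<sigma>" "2 * \<sigma> + 1 \<le> real m" using s2 small by (auto simp: \<sigma>_def s_def m_def)
    have \<epsilon>1: "1 \<le> \<epsilon> \<or> \<epsilon> = 0 \<and> 7 \<le> real m" using \<beta> by (auto simp: \<epsilon>_def m_def)
    have q_le: "q \<le> real \<beta>" using d_le by (simp add: q_def)
    have qpos: "0 < q" using mq b1 b2 \<sigma> \<epsilon>1 by auto
    have ineq: "real \<beta> + q / (\<sigma> + 1) < 1 + (real m - b)\<^sup>2 * real \<beta> / (real m * q)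
        + (real \<beta> - 1 - b)\<^sup>2 / real \<alpha> + (b - \<epsilon>)\<^sup>2 / real m + b\<^sup>2 / \<sigma>"
      by (rule density_inequality[OF mq _ q_le \<sigma> b1 b2 \<epsilon>1]) (simp add: \<epsilon>_def)
    have cardR: "real \<beta> * real (card R) = real m * q"
    proof -
      have "card R + m = card (second_sphere x)"
        using exclusive_swap_subset_second_sphere[OF xy] m'
          card_mono[OF finite_second_sphere exclusive_swap_subset_second_sphere[OF xy]]
        by (simp add: R_def card_Diff_subset)
      then have "\<beta> * (card R + m) = d * m" using card_second_sphere[OF xy] by (simp add: m_def)
      then have "real \<beta> * (real (card R) + real m) = real d * real m"
        by (metis of_nat_add of_nat_mult)
      then show ?thesis by (simp add: q_def algebra_simps)
    qed
    have \<beta>pos: "0 < real \<beta>" using \<beta> by auto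
    have fR: "(real s)\<^sup>2 * ((real m - b)\<^sup>2 * real \<beta> / (real m * q)) \<le> sum f R"
    proof -
      have "real (\<Sum>w\<in>R. card (N w \<inter> S)) = real s * (real m - b)"
        using arg_cong[OF eR, of real] sb by (simp add: algebra_simps)
      moreover have "real (card R) = real m * q / real \<beta>" using cardR \<beta>pos by (simp add: field_simps)
      ultimately show ?thesis
        using cauchy_schwarz_edges[of S R] \<beta>pos by (simp add: f_def power_mult_distrib)
    qed
    have fD: "(real s)\<^sup>2 * ((real \<beta> - 1 - b)\<^sup>2 / real \<alpha>) \<le> sum f \<Delta>"
    proof -
      have "real (\<Sum>w\<in>\<Delta>. card (N w \<inter> S)) = real s * (real \<beta> - 1 - b)"
        using arg_cong[OF eD, of real] sb by (simp add: algebra_simps)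
      then show ?thesis
        using cauchy_schwarz_edges[of S \<Delta>] common_adjacent[OF xy] by (simp add: f_def \<Delta>_def power_mult_distrib)
    qed
    have fA: "(real s)\<^sup>2 * ((b - \<epsilon>)\<^sup>2 / real m) \<le> sum f A"
    proof -
      have "real (\<Sum>w\<in>A. card (N w \<inter> S)) = real s * (b - \<epsilon>)"
        using arg_cong[OF eA, of real] sb
        unfolding \<epsilon>_nat of_nat_add of_nat_mult right_diff_distrib by linarith
      then show ?thesis
        using cauchy_schwarz_edges[of S A] by (simp add: f_def A_def m_def power_mult_distrib)
    qed
    have fB: "(real s)\<^sup>2 * (b\<^sup>2 / \<sigma>) \<le> sum f B"
    proof (cases "card B = 0")
      case True
      then have "c = 0" using eB fin by simp
      then show ?thesis by (simp add: b_def f_def sum_nonneg)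
    next
      case False
      have "(real s)\<^sup>2 * (b\<^sup>2 / \<sigma>) = (real c)\<^sup>2 / \<sigma>" using sb by (simp add: power_mult_distrib[symmetric])
      also have "\<dots> \<le> (real c)\<^sup>2 / card B"
        using False Bs by (intro divide_left_mono) (auto simp: \<sigma>_def)
      also have "\<dots> \<le> sum f B"
        using cauchy_schwarz_edges[of S B] arg_cong[OF eB, of real] by (simp add: f_def)
      finally show ?thesis .
    qed
    have "(real s)\<^sup>2 * (real \<beta> + q / (\<sigma> + 1)) = real s * (real d + (real s - 1) * real \<beta>)"
      using spos by (simp add: \<sigma>_def q_def power2_eq_square field_simps)
    moreover have "(real s)\<^sup>2 * (real \<beta> + q / (\<sigma> + 1)) < (real s)\<^sup>2 * (1 + (real m - b)\<^sup>2 * real \<beta> / (real m * q)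
        + (real \<beta> - 1 - b)\<^sup>2 / real \<alpha> + (b - \<epsilon>)\<^sup>2 / real m + b\<^sup>2 / \<sigma>)"
      using ineq spos by (intro mult_strict_left_mono) auto
    ultimately show False
      using moment fR fD fA fB by (simp only: distrib_left mult_1_right)
  qed
qed

text \<open>
A violation \<open>J\<close> of Hall's condition is shrunk to a set \<open>S\<close> with exactly one element more than there are
neighbours of \<open>J\<close> in \<open>B\<close>. If \<open>2 |S| > m + 1\<close>, the set \<open>T\<close> of the vertices of \<open>B\<close> without
neighbours in \<open>J\<close> has at most \<open>m / 2\<close> elements, and it is deficient as well, since it only sees \<open>A - S\<close>.
\<close>
lemma perfect_matching_of_exclusive_neighbours:
  assumes xy: "y \<in> N x" and few: "card V + 2 * \<alpha> < 3 * d"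
    and \<beta>: "\<alpha> + 2 \<le> \<beta> \<or> \<beta> = \<alpha> + 1 \<and> 7 \<le> card (exclusive x y)"
  shows "\<exists>f. bij_betw f (exclusive x y) (exclusive y x) \<and> (\<forall>u\<in>exclusive x y. f u \<in> N u)"
proof -
  define m where "m = card (exclusive x y)"
  have yx: "x \<in> N y" using xy by (rule N_sym)
  have m': "card (exclusive y x) = m"
    using card_exclusive[OF xy] card_exclusive[OF yx] by (simp add: m_def)
  have "card J \<le> card (\<Union>u\<in>J. N u \<inter> exclusive y x)" if J: "J \<subseteq> exclusive x y" for J
  proof (rule ccontr)
    assume less: "\<not> ?thesis"
    define B where "B = (\<Union>u\<in>J. N u \<inter> exclusive y x)"
    have B: "B \<subseteq> exclusive y x" by (auto simp: B_def)
    have "card B + 1 \<le> card J" using less by (simp add: B_def)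
    then obtain S where S: "S \<subseteq> J" "card S = card B + 1" "finite S"
      by (rule obtain_subset_with_card_n)
    have S_le: "card S \<le> m" using S J unfolding m_def by (intro card_mono) auto
    show False
    proof (cases "2 * card S \<le> m + 1")
      case True
      have "card S \<le> card {v \<in> exclusive y x. N v \<inter> S \<noteq> {}}"
        using S J True by (intro no_deficient_set[OF xy few \<beta>]) (auto simp: m_def)
      also have "\<dots> \<le> card B"
        using S N_sym B by (intro card_mono) (auto simp: B_def intro: finite_subset)
      finally show False using S by simp
    next
      case False
      define T where "T = exclusive y x - B"
      have T: "card T = m - card B"
        using B finite_subset[OF B] m' by (simp add: T_def card_Diff_subset)
      then have "card T \<noteq> 0" using S S_le by simp
      then have "T \<noteq> {}" by auto
      then have "card T \<le> card {v \<in> exclusive x y. N v \<inter> T \<noteq> {}}"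
        using False T S m' \<beta>
        by (intro no_deficient_set[OF yx few]) (auto simp: T_def m_def)
      also have "\<dots> \<le> card (exclusive x y - S)"
        using S by (intro card_mono) (auto simp: T_def B_def)
      also have "\<dots> = m - card S"
        using S J by (subst card_Diff_subset) (auto simp: m_def)
      finally show False using T S S_le by simp
    qed
  qed
  then obtain f where f: "inj_on f (exclusive x y)" "\<forall>u\<in>exclusive x y. f u \<in> N u \<inter> exclusive y x"
    using hall_marriage[of "exclusive x y" "\<lambda>u. N u \<inter> exclusive y x"] by auto
  have "f ` exclusive x y = exclusive y x"
    using f m' by (intro card_subset_eq) (auto simp: card_image m_def)
  then show ?thesis using f by (auto simp: bij_betw_def)
qed

end

section \<open>Distance and transport\<close>

lemma graph_dist_le_walk:
  assumes "wf_digraph (with_proj G)" "pre_digraph.awalk (with_proj G) u p v"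
  shows "graph_dist G u v \<le> ereal (length p)"
proof -
  interpret wf_digraph "with_proj G" by fact
  have "awalk_cost (\<lambda>_. 1) p = length p" by (induction p) auto
  then show ?thesis
    using min_cost_le_walk_cost[OF assms(2), of "\<lambda>_. 1"] by (simp add: graph_dist_def)
qed

lemma le_graph_distI:
  assumes "wf_digraph (with_proj G)"
    and "\<And>p. pre_digraph.awalk (with_proj G) u p v \<Longrightarrow> c \<le> ereal (length p)"
  shows "c \<le> graph_dist G u v"
proof -
  interpret wf_digraph "with_proj G" by fact
  have "awalk_cost (\<lambda>_. 1) p = length p" for p by (induction p) auto
  then show ?thesis using assms(2) by (auto simp: graph_dist_def \<mu>_def intro!: INF_greatest)
qed

context pair_graph begin

lemma wf_with_proj: "wf_digraph (with_proj G)" ..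

lemma graph_dist_refl: "u \<in> pverts G \<Longrightarrow> graph_dist G u u = 0"
  using graph_dist_le_walk[OF wf_with_proj, of u "[]" u] le_graph_distI[OF wf_with_proj, of u u 0]
  by (simp add: awalk_Nil_iff zero_ereal_def[symmetric])

lemma graph_dist_ge_1:
  assumes "u \<noteq> v"
  shows "1 \<le> graph_dist G u v"
proof (rule le_graph_distI[OF wf_with_proj])
  fix p assume "awalk u p v"
  then have "p \<noteq> []" using assms by (auto simp: awalk_Nil_iff)
  then have "1 \<le> length p" by (cases p) auto
  then show "1 \<le> ereal (length p)" by (simp add: one_ereal_def)
qed

lemma graph_dist_edge:
  assumes "(u, v) \<in> parcs G"
  shows "graph_dist G u v = 1"
proof (rule antisym)
  have "awalk u [(u, v)] v" using assms by (simp add: awalk_def in_arcsD1)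
  from graph_dist_le_walk[OF wf_with_proj this] show "graph_dist G u v \<le> 1" by (simp add: one_ereal_def)
  show "1 \<le> graph_dist G u v" using pair_no_loops[OF assms] by (intro graph_dist_ge_1) auto
qed

lemma graph_dist_eq_2:
  assumes "u \<noteq> v" "(u, v) \<notin> parcs G" "(u, w) \<in> parcs G" "(w, v) \<in> parcs G"
  shows "graph_dist G u v = 2"
proof (rule antisym)
  have "awalk u [(u, w), (w, v)] v" using assms by (simp add: awalk_def in_arcsD1)
  from graph_dist_le_walk[OF wf_with_proj this] show "graph_dist G u v \<le> 2" by simp
  show "2 \<le> graph_dist G u v"
  proof (rule le_graph_distI[OF wf_with_proj])
    fix p assume p: "awalk u p v"
    then have "p \<noteq> []" using assms by (auto simp: awalk_Nil_iff)
    moreover have "p \<noteq> [e]" for e using p assms by (cases e) (auto simp: awalk_def)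
    ultimately have "2 \<le> length p" by (cases p; cases "tl p") auto
    then show "2 \<le> ereal (length p)" by simp
  qed
qed

text \<open>
All mass off the diagonal travels distance at least \<open>1\<close>, and distance exactly \<open>1\<close> if it moves along edges.
The bound also holds when a plan moves mass between different components, at infinite cost.
\<close>
lemma transport_cost_resting_mass:
  assumes "\<pi> \<in> transport_plans G \<mu>1 \<mu>2" and "sum \<mu>1 (pverts G) = 1"
  shows "ereal (1 - (\<Sum>z\<in>pverts G. \<pi> z z))
    \<le> (\<Sum>w\<in>pverts G. \<Sum>z\<in>pverts G. graph_dist G z w * ereal (\<pi> z w))"
    and "(\<And>z w. z \<in> pverts G \<Longrightarrow> w \<in> pverts G \<Longrightarrow> \<pi> z w \<noteq> 0 \<Longrightarrow> z = w \<or> (z, w) \<in> parcs G) \<Longrightarrow>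
      (\<Sum>w\<in>pverts G. \<Sum>z\<in>pverts G. graph_dist G z w * ereal (\<pi> z w))
      = ereal (1 - (\<Sum>z\<in>pverts G. \<pi> z z))"
proof -
  let ?V = "pverts G"
  define moved where "moved z w = (if z = w then 0 else \<pi> z w)" for z w
  have \<pi>: "0 \<le> \<pi> z w" if "z \<in> ?V" "w \<in> ?V" for z w
    using assms(1) that by (auto simp: transport_plans_def)
  have "(\<Sum>w\<in>?V. \<Sum>z\<in>?V. moved z w) = (\<Sum>z\<in>?V. \<Sum>w\<in>?V. moved z w)"
    by (rule sum.swap)
  also have "\<dots> = (\<Sum>z\<in>?V. \<mu>1 z - \<pi> z z)"
  proof (rule sum.cong[OF refl])
    fix z assume z: "z \<in> ?V"
    have "(\<Sum>w\<in>?V. moved z w) = (\<Sum>w\<in>?V. \<pi> z w - (if z = w then \<pi> z w else 0))"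
      by (rule sum.cong) (auto simp: moved_def)
    also have "\<dots> = \<mu>1 z - \<pi> z z"
      using z assms(1) pair_finite_verts by (simp add: sum_subtractf transport_plans_def)
    finally show "(\<Sum>w\<in>?V. moved z w) = \<mu>1 z - \<pi> z z" .
  qed
  also have "\<dots> = 1 - (\<Sum>z\<in>?V. \<pi> z z)" by (simp add: sum_subtractf assms(2))
  finally have total: "ereal (1 - (\<Sum>z\<in>?V. \<pi> z z)) = (\<Sum>w\<in>?V. \<Sum>z\<in>?V. ereal (moved z w))"
    by simp
  have "ereal (moved z w) \<le> graph_dist G z w * ereal (\<pi> z w)" if "z \<in> ?V" "w \<in> ?V" for z w
    using ereal_mult_right_mono[OF graph_dist_ge_1, of z w "ereal (\<pi> z w)"] \<pi>[OF that] that
    by (cases "z = w") (auto simp: moved_def graph_dist_refl)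
  then show "ereal (1 - (\<Sum>z\<in>?V. \<pi> z z)) \<le> (\<Sum>w\<in>?V. \<Sum>z\<in>?V. graph_dist G z w * ereal (\<pi> z w))"
    unfolding total by (intro sum_mono) auto
  assume edges: "\<And>z w. z \<in> ?V \<Longrightarrow> w \<in> ?V \<Longrightarrow> \<pi> z w \<noteq> 0 \<Longrightarrow> z = w \<or> (z, w) \<in> parcs G"
  have "graph_dist G z w * ereal (\<pi> z w) = ereal (moved z w)" if "z \<in> ?V" "w \<in> ?V" for z w
  proof (cases "\<pi> z w = 0 \<or> z = w")
    case True
    then show ?thesis
      using that by (auto simp: moved_def graph_dist_refl zero_ereal_def[symmetric])
  next
    case False
    then have "graph_dist G z w = 1" using edges[OF that] by (intro graph_dist_edge) auto
    then show ?thesis using False by (simp add: moved_def)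
  qed
  then show "(\<Sum>w\<in>?V. \<Sum>z\<in>?V. graph_dist G z w * ereal (\<pi> z w)) = ereal (1 - (\<Sum>z\<in>?V. \<pi> z z))"
    unfolding total by (intro sum.cong) auto
qed

abbreviation nbrs :: "'a \<Rightarrow> 'a set" where
  "nbrs u \<equiv> {v. (u, v) \<in> parcs G}"

lemma nbrs_subset: "nbrs u \<subseteq> pverts G"
  by (auto simp: in_arcsD2)

lemma finite_nbrs: "finite (nbrs u)"
  using nbrs_subset pair_finite_verts by (rule finite_subset)

lemma edge_sym: "(u, v) \<in> parcs G \<Longrightarrow> (v, u) \<in> parcs G"
  using pair_sym_arcs by (auto simp: symmetric_def dest: symD)

lemma out_degree_eq_card_nbrs: "out_degree (with_proj G) u = card (nbrs u)"
proof -
  have "out_arcs (with_proj G) u = Pair u ` nbrs u" by (auto simp: out_arcs_def)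
  then show ?thesis by (simp add: out_degree_def card_image inj_on_def)
qed

text \<open>
Both inequalities compare the resting mass with \<open>h = (1 - p) / d\<close> on \<open>C = {x, y} \<union> \<Delta>\<close>. For \<open>p \<ge> 1 / 2\<close> one
has \<open>h \<le> p\<close>, so \<open>h\<close> is the smaller of the two densities at every point of \<open>C\<close> and no plan can keep more
in place. The optimal plan keeps \<open>h\<close> at every point of \<open>C\<close>, sends \<open>h\<close> along each edge of the matching
\<open>f\<close>, and moves the surplus \<open>p - h\<close> from \<open>x\<close> to \<open>y\<close>.
\<close>
lemma wasserstein_lazy_walk_matching:
  assumes edge: "(x, y) \<in> parcs G"
    and deg: "card (nbrs x) = d" "card (nbrs y) = d"
    and f: "bij_betw f (nbrs x - nbrs y - {y}) (nbrs y - nbrs x - {x})"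
      "\<And>u. u \<in> nbrs x - nbrs y - {y} \<Longrightarrow> (u, f u) \<in> parcs G"
    and p: "1 / 2 \<le> p" "p \<le> 1"
  shows "wasserstein G (lazy_walk G p x) (lazy_walk G p y)
    = ereal (1 - (1 - p) * (2 + card (common_neighbors G x y)) / d)"
proof -
  let ?V = "pverts G"
  define h where "h = (1 - p) / d"
  have xy: "x \<noteq> y" "x \<in> ?V" "y \<in> ?V" "y \<in> nbrs x" "x \<in> nbrs y" "x \<notin> nbrs x" "y \<notin> nbrs y"
    using edge edge_sym[OF edge] pair_no_loops[of "(x, x)"] pair_no_loops[of "(y, y)"]
    by (auto simp: in_arcsD1 in_arcsD2)
  have dpos: "1 \<le> d" using xy deg(1) finite_nbrs[of x] by (metis One_nat_def Suc_leI card_gt_0_iff empty_iff)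
  have h: "0 \<le> h" "h \<le> p" "real d * h = 1 - p"
  proof -
    have "(1 - p) / real d \<le> (1 - p) / 1" using dpos p by (intro divide_left_mono) auto
    then show "h \<le> p" using p by (simp add: h_def)
  qed (use p dpos in \<open>auto simp: h_def\<close>)
  have lazy: "lazy_walk G p u z = (if z = u then p else if z \<in> nbrs u then h else 0)"
    if "card (nbrs u) = d" for u z
    using that by (simp add: lazy_walk_def out_degree_eq_card_nbrs h_def)
  have total: "sum (lazy_walk G p x) ?V = 1"
  proof -
    have "sum (lazy_walk G p x) ?V = sum (lazy_walk G p x) (insert x (nbrs x))"
      using pair_finite_verts xy nbrs_subset
      by (intro sum.mono_neutral_right) (auto simp: lazy[OF deg(1)])
    also have "\<dots> = p + sum (lazy_walk G p x) (nbrs x)"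
      using xy finite_nbrs by (subst sum.insert) (auto simp: lazy[OF deg(1)])
    also have "sum (lazy_walk G p x) (nbrs x) = (\<Sum>z\<in>nbrs x. h)"
      using xy by (intro sum.cong) (auto simp: lazy[OF deg(1)])
    finally show ?thesis using deg h by simp
  qed
  define C where "C = insert x (insert y (common_neighbors G x y))"
  have C: "C = insert x (nbrs x) \<inter> insert y (nbrs y)"
    using xy by (auto simp: C_def common_neighbors_def)
  have finC: "finite C" using finite_nbrs by (simp add: C)
  have card_C: "real (card C) = 2 + card (common_neighbors G x y)"
    using xy finC by (simp add: C_def common_neighbors_def)
  have C_sub: "C \<subseteq> ?V" using xy nbrs_subset by (auto simp: C)
  have cost_goal: "ereal (1 - (1 - p) * (2 + card (common_neighbors G x y)) / d) = ereal (1 - card C * h)"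
    using card_C by (simp add: h_def)
  show ?thesis unfolding cost_goal
  proof (rule antisym)
    \<comment> \<open>Apart from the surplus at \<open>x\<close>, the plan transports the uniform density \<open>h\<close> along the bijection \<open>g\<close>
       between the closed neighbourhoods of \<open>x\<close> and \<open>y\<close>.\<close>
    define g where "g z = (if z \<in> nbrs x - nbrs y - {y} then f z else z)" for z
    define \<pi> where "\<pi> z w = (if z \<in> insert x (nbrs x) \<and> w = g z then h else 0)
        + (if z = x \<and> w = y then p - h else 0)" for z w
    have g_inj: "bij_betw g (insert x (nbrs x)) (insert y (nbrs y))"
    proof -
      have "bij_betw g ((nbrs x - nbrs y - {y}) \<union> C) ((nbrs y - nbrs x - {x}) \<union> C)"
      proof (rule bij_betw_combine)
        show "bij_betw g (nbrs x - nbrs y - {y}) (nbrs y - nbrs x - {x})"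
          using f(1) by (subst bij_betw_cong[of _ g f]) (auto simp: g_def)
        have "g z = z" if "z \<in> C" for z using that xy by (auto simp: g_def C)
        then show "bij_betw g C C" by (auto simp: bij_betw_def inj_on_def)
        show "(nbrs y - nbrs x - {x}) \<inter> C = {}" by (auto simp: C)
      qed
      moreover have "(nbrs x - nbrs y - {y}) \<union> C = insert x (nbrs x)"
        "(nbrs y - nbrs x - {x}) \<union> C = insert y (nbrs y)" using xy by (auto simp: C)
      ultimately show ?thesis by simp
    qed
    have g_V: "g z \<in> ?V" if "z \<in> insert x (nbrs x)" for z
    proof -
      have "g z \<in> insert y (nbrs y)" using g_inj that by (auto simp: bij_betw_def)
      then show ?thesis using xy nbrs_subset by auto
    qed
    have nbx: "insert x (nbrs x) \<subseteq> ?V" using xy nbrs_subset by auto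
    have row: "(\<Sum>w\<in>?V. \<pi> z w) = lazy_walk G p x z" if "z \<in> ?V" for z
    proof -
      have "(\<Sum>w\<in>?V. \<pi> z w) = (\<Sum>w\<in>?V. if w = g z then (if z \<in> insert x (nbrs x) then h else 0) else 0)
          + (\<Sum>w\<in>?V. if w = y then (if z = x then p - h else 0) else 0)"
        unfolding sum.distrib[symmetric] by (intro sum.cong) (auto simp: \<pi>_def)
      also have "\<dots> = lazy_walk G p x z"
        using pair_finite_verts g_V[of z] g_V[of x] xy by (simp add: lazy[OF deg(1)])
      finally show ?thesis .
    qed
    have column: "(\<Sum>z\<in>?V. \<pi> z w) = lazy_walk G p y w" if "w \<in> ?V" for w
    proof -
      have "(\<Sum>z\<in>?V. \<pi> z w) = (\<Sum>z\<in>?V. if z \<in> insert x (nbrs x) \<and> w = g z then h else 0)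
          + (\<Sum>z\<in>?V. if z = x then (if w = y then p - h else 0) else 0)"
        unfolding sum.distrib[symmetric] by (intro sum.cong) (auto simp: \<pi>_def)
      also have "(\<Sum>z\<in>?V. if z \<in> insert x (nbrs x) \<and> w = g z then h else 0)
          = (\<Sum>z\<in>insert x (nbrs x). if w = g z then h else 0)"
        using pair_finite_verts nbx by (intro sum.mono_neutral_cong_right) auto
      also have "\<dots> = (\<Sum>v\<in>insert y (nbrs y). if w = v then h else 0)"
        by (rule sum.reindex_bij_betw[OF g_inj])
      also have "\<dots> + (\<Sum>z\<in>?V. if z = x then (if w = y then p - h else 0) else 0) = lazy_walk G p y w"
        using pair_finite_verts finite_nbrs[of y] xy by (simp add: lazy[OF deg(2)])
      finally show ?thesis .
    qed
    have nonneg: "0 \<le> \<pi> z w" for z w using h by (auto simp: \<pi>_def)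
    have plan: "\<pi> \<in> transport_plans G (lazy_walk G p x) (lazy_walk G p y)"
    proof -
      have "\<pi> z w \<le> 1" if "z \<in> ?V" "w \<in> ?V" for z w
      proof -
        have "\<pi> z w \<le> (\<Sum>w\<in>?V. \<pi> z w)"
          using that nonneg pair_finite_verts by (intro member_le_sum) auto
        also have "\<dots> \<le> 1" using that h p by (simp add: row lazy[OF deg(1)])
        finally show ?thesis .
      qed
      then show ?thesis using row column nonneg by (auto simp: transport_plans_def)
    qed
    have "(\<Sum>w\<in>?V. \<Sum>z\<in>?V. graph_dist G z w * ereal (\<pi> z w)) = ereal (1 - (\<Sum>z\<in>?V. \<pi> z z))"
      using plan total
    proof (rule transport_cost_resting_mass(2))
      fix z w assume "\<pi> z w \<noteq> 0"
      then show "z = w \<or> (z, w) \<in> parcs G"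
        using f(2) edge by (auto simp: \<pi>_def g_def split: if_splits)
    qed
    moreover have "(\<Sum>z\<in>?V. \<pi> z z) = (\<Sum>z\<in>C. h)"
    proof (rule sum.mono_neutral_cong_right[OF pair_finite_verts C_sub])
      have g_fix: "z = g z \<longleftrightarrow> z \<in> C" if "z \<in> insert x (nbrs x)" for z
        using that bij_betw_apply[OF f(1), of z] xy by (auto simp: g_def C)
      show "\<forall>z\<in>?V - C. \<pi> z z = 0"
      proof
        fix z assume z: "z \<in> ?V - C"
        then have "\<not> (z \<in> insert x (nbrs x) \<and> z = g z)" using g_fix by blast
        moreover have "z \<noteq> x" using z by (auto simp: C_def)
        ultimately show "\<pi> z z = 0"
          unfolding \<pi>_def by (simp only: simp_thms if_False add_0_right)
      qed
      fix z assume z: "z \<in> C"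
      then have "z \<in> insert x (nbrs x)" by (simp add: C)
      moreover from this z have "z = g z" using g_fix by blast
      moreover have "\<not> (z = x \<and> z = y)" using xy(1) by blast
      ultimately show "\<pi> z z = h" unfolding \<pi>_def by (simp only: simp_thms if_True if_False add_0_right)
    qed
    ultimately have "(\<Sum>w\<in>?V. \<Sum>z\<in>?V. graph_dist G z w * ereal (\<pi> z w)) = ereal (1 - card C * h)"
      by (simp only: sum_constant)
    then show "wasserstein G (lazy_walk G p x) (lazy_walk G p y) \<le> ereal (1 - card C * h)"
      unfolding wasserstein_def by (intro INF_lower2[OF plan]) (rule eq_refl)
  next
    show "ereal (1 - card C * h) \<le> wasserstein G (lazy_walk G p x) (lazy_walk G p y)"
      unfolding wasserstein_def
    proof (rule INF_greatest)
      fix \<pi> assume plan: "\<pi> \<in> transport_plans G (lazy_walk G p x) (lazy_walk G p y)"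
      have "(\<Sum>z\<in>?V. \<pi> z z) \<le> (\<Sum>z\<in>?V. if z \<in> C then h else 0)"
      proof (rule sum_mono)
        fix z assume z: "z \<in> ?V"
        have nonneg: "0 \<le> \<pi> v w" if "v \<in> ?V" "w \<in> ?V" for v w
          using plan that by (auto simp: transport_plans_def)
        have "\<pi> z z \<le> (\<Sum>w\<in>?V. \<pi> z w)" "\<pi> z z \<le> (\<Sum>w\<in>?V. \<pi> w z)"
          using z nonneg pair_finite_verts
          by (auto intro: member_le_sum[of z ?V "\<pi> z"] member_le_sum[of z ?V "\<lambda>w. \<pi> w z"])
        then have "\<pi> z z \<le> lazy_walk G p x z" "\<pi> z z \<le> lazy_walk G p y z"
          using plan z by (simp_all add: transport_plans_def)
        then show "\<pi> z z \<le> (if z \<in> C then h else 0)"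
          using xy by (auto simp: lazy[OF deg(1)] lazy[OF deg(2)] C split: if_splits)
      qed
      also have "\<dots> = card C * h"
        using pair_finite_verts C_sub by (simp add: sum.If_cases Int_absorb1)
      finally have "ereal (1 - card C * h) \<le> ereal (1 - (\<Sum>z\<in>?V. \<pi> z z))" by simp
      also have "\<dots> \<le> (\<Sum>w\<in>?V. \<Sum>z\<in>?V. graph_dist G z w * ereal (\<pi> z w))"
        using plan total by (rule transport_cost_resting_mass(1))
      finally show "ereal (1 - card C * h)
        \<le> (\<Sum>w\<in>?V. \<Sum>z\<in>?V. graph_dist G z w * ereal (\<pi> z w))" .
    qed
  qed
qed

text \<open>
The quotient in the definition of the curvature is constant on \<open>1 / 2 < p < 1\<close>.
\<close>
lemma lly_curvature_of_matching:
  assumes edge: "(x, y) \<in> parcs G"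
    and deg: "card (nbrs x) = d" "card (nbrs y) = d"
    and f: "bij_betw f (nbrs x - nbrs y - {y}) (nbrs y - nbrs x - {x})"
      "\<And>u. u \<in> nbrs x - nbrs y - {y} \<Longrightarrow> (u, f u) \<in> parcs G"
  defines "\<kappa> \<equiv> (2 + real (card (common_neighbors G x y))) / real d"
  shows "((\<lambda>p. ollivier_curvature G p x y / (1 - p)) \<longlongrightarrow> \<kappa>) (at_left 1)"
    and "lly_curvature G x y = \<kappa>"
proof -
  have "ollivier_curvature G p x y / (1 - p) = \<kappa>" if "1 / 2 < p" "p < 1" for p
    using wasserstein_lazy_walk_matching[OF edge deg f, of p] that
    by (simp add: ollivier_curvature_def graph_dist_edge[OF edge] \<kappa>_def)
  then have "\<forall>\<^sub>F p in at_left 1. ollivier_curvature G p x y / (1 - p) = \<kappa>"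
    by (auto simp: eventually_at_left_field intro!: exI[of _ "1 / 2"])
  then show lim: "((\<lambda>p. ollivier_curvature G p x y / (1 - p)) \<longlongrightarrow> \<kappa>) (at_left 1)"
    by (rule tendsto_eventually)
  then show "lly_curvature G x y = \<kappa>"
    unfolding lly_curvature_def by (intro tendsto_Lim) auto
qed

end

lemma amply_regular_imp_neighbourhoods:
  assumes "amply_regular G n d \<alpha> \<beta>"
  shows "amply_regular_neighbourhoods (pverts G) (\<lambda>u. {v. (u, v) \<in> parcs G}) d \<alpha> \<beta>"
proof -
  interpret pair_graph G using assms by (simp add: amply_regular_def)
  have common: "common_neighbors G u v = nbrs u \<inter> nbrs v" for u v
    by (auto simp: common_neighbors_def)
  show ?thesis
  proof (unfold_locales, goal_cases)
    case 1 show ?case by (rule pair_finite_verts)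
  next
    case (2 u) show ?case by (rule nbrs_subset)
  next
    case (3 v u) then show ?case by (simp add: edge_sym)
  next
    case (4 u) show ?case using pair_no_loops[of "(u, u)"] by auto
  next
    case (5 u) then show ?case using assms by (simp add: amply_regular_def out_degree_eq_card_nbrs)
  next
    case (6 v u)
    then show ?case using assms by (simp add: amply_regular_def common[symmetric] in_arcsD1 in_arcsD2)
  next
    case (7 u v)
    then obtain w where w: "(u, w) \<in> parcs G" "(w, v) \<in> parcs G" using edge_sym by auto
    then have "graph_dist G u v = 2" using 7 by (intro graph_dist_eq_2) auto
    then show ?case
      using assms w by (simp add: amply_regular_def common[symmetric] in_arcsD1 in_arcsD2)
  qed
qed

theorem theorem1p3:
  fixes G :: "'a pair_pre_digraph" and n d \<alpha> \<beta> :: nat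
  assumes "amply_regular G n d \<alpha> \<beta>"
    and "real n < 3 * real d - 2 * real \<alpha>"
    and "(\<beta> = \<alpha> + 1 \<and> real d > real \<alpha> + sqrt (6 * real \<alpha> + 1 / 4) + 3 / 2)
       \<or> (\<beta> \<ge> \<alpha> + 2
           \<and> 4 * (real \<alpha>)\<^sup>2 - 3 * (real \<beta>)\<^sup>2 + 28 * real \<beta> \<ge> 0
           \<and> real d \<ge> 3 / 2 * real \<beta>
               + 1 / 2 * sqrt (4 * (real \<alpha>)\<^sup>2 - 3 * (real \<beta>)\<^sup>2 + 28 * real \<beta>))
       \<or> real \<beta> \<ge> 2 * sqrt 3 / 3 * real \<alpha> + 7"
  shows "\<forall>(x, y)\<in>parcs G.
           ((\<lambda>p. ollivier_curvature G p x y / (1 - p)) \<longlongrightarrow> lly_curvature G x y) (at_left 1)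
           \<and> lly_curvature G x y = (2 + real \<alpha>) / real d"
proof -
  interpret pair_graph G using assms(1) by (simp add: amply_regular_def)
  interpret N: amply_regular_neighbourhoods "pverts G" nbrs d \<alpha> \<beta>
    using assms(1) by (rule amply_regular_imp_neighbourhoods)
  have "card (pverts G) = n" using assms(1) by (simp add: amply_regular_def)
  then have few: "card (pverts G) + 2 * \<alpha> < 3 * d" using assms(2) by linarith
  show ?thesis
  proof (clarify, goal_cases)
    case (1 x y)
    then have y: "y \<in> nbrs x" by simp
    define m where "m = card (N.exclusive x y)"
    have d: "d = m + \<alpha> + 1" using N.card_exclusive[OF y] by (simp add: m_def)
    \<comment> \<open>In the first case the bound on \<open>d\<close> says \<open>6 \<alpha> < m (m - 1)\<close>, and \<open>d \<le> 2 \<beta>\<close> says \<open>m \<le> \<alpha> + 1\<close>; hence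
       \<open>m > 6\<close>.\<close>
    have "\<alpha> + 2 \<le> \<beta> \<or> \<beta> = \<alpha> + 1 \<and> 7 \<le> m"
      using assms(3)
    proof (elim disjE conjE)
      assume \<beta>: "\<beta> = \<alpha> + 1" and "real d > real \<alpha> + sqrt (6 * real \<alpha> + 1 / 4) + 3 / 2"
      then have "sqrt (6 * real \<alpha> + 1 / 4) < real m - 1 / 2" using d by simp
      moreover from this have "0 \<le> real m - 1 / 2"
        using real_sqrt_ge_zero[of "6 * real \<alpha> + 1 / 4"] by linarith
      ultimately have "6 * real \<alpha> + 1 / 4 < (real m - 1 / 2)\<^sup>2"
        by (metis abs_of_nonneg real_sqrt_abs real_sqrt_less_iff)
      then have big: "6 * real \<alpha> < real m * (real m - 1)"
        by (simp add: power2_eq_square algebra_simps)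
      have "m \<noteq> 0" by (rule notI) (use big in simp)
      moreover have "m \<noteq> 1" by (rule notI) (use big in simp)
      ultimately have m2: "2 \<le> m" by simp
      then have "N.exclusive x y \<noteq> {}" by (auto simp: m_def)
      then have "m \<le> \<alpha> + 1" using N.degree_le_twice_beta[OF y few] d \<beta> by simp
      then have "6 * (real m - 1) \<le> 6 * real \<alpha>" by simp
      also note big
      finally have "6 * (real m - 1) < real m * (real m - 1)" .
      then have "6 < real m" by (rule mult_right_less_imp_less) (use m2 in simp)
      then show ?thesis using \<beta> by simp
    next
      assume \<beta>: "real \<beta> \<ge> 2 * sqrt 3 / 3 * real \<alpha> + 7"
      have "3 / 2 \<le> sqrt 3" by (rule real_le_rsqrt) (simp add: power2_eq_square)
      then have "1 * real \<alpha> \<le> 2 * sqrt 3 / 3 * real \<alpha>" by (intro mult_right_mono) auto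
      then show ?thesis using \<beta> by linarith
    qed simp
    then obtain f where f: "bij_betw f (N.exclusive x y) (N.exclusive y x)"
        "\<forall>u\<in>N.exclusive x y. f u \<in> nbrs u"
      unfolding m_def using N.perfect_matching_of_exclusive_neighbours[OF y few] by blast
    have deg: "card (nbrs x) = d" "card (nbrs y) = d" using N.degree N.in_V[OF y] by blast+
    have "common_neighbors G x y = nbrs x \<inter> nbrs y" by (auto simp: common_neighbors_def)
    then have \<alpha>: "card (common_neighbors G x y) = \<alpha>" using N.common_adjacent[OF y] by (simp only:)
    have matched: "(u, f u) \<in> parcs G" if "u \<in> nbrs x - nbrs y - {y}" for u
      using f(2) that unfolding N.exclusive_def by blast
    note curvature = lly_curvature_of_matching[OF 1 deg f(1)[unfolded N.exclusive_def] matched]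
    show ?case using curvature unfolding \<alpha> by (simp only: of_nat_id)
  qed
qed

end
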